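(* Let $\mathbb{K}$ be an algebraically closed field of characteristic $0$ and let $\alpha,\alpha',\gamma,\gamma'\in\mathbb{K}$. The down-up algebras $A(\alpha,0,\gamma)$ and $A(\alpha',0,\gamma')$ are isomorphic as $\mathbb{K}$-algebras if and only if (1) $\gamma=\lambda\gamma'$ for some $\lambda\in\mathbb{K}^\times$ (equivalently, $\gamma$ and $\gamma'$ are both zero or both nonzero), and (2) $\alpha'=\alpha$.
   Context: For $(\alpha,\beta,\gamma)\in\mathbb{K}^3$, the down-up algebra $A(\alpha,\beta,\gamma)$ is the quotient of the free associative algebra $\mathbb{K}\langle d,u\rangle$ by the two-sided ideal generated by $d^2u-(\alpha dud+\beta ud^2+\gamma d)$ and $du^2-(\alpha udu+\beta u^2d+\gamma u)$. *)

theory Defs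
  imports "HOL-Computational_Algebra.Polynomial"
begin

text \<open>Free associative algebra K<d,u>: finitely supported functions on words over
  the alphabet {d,u}, encoded as bool lists (False = d, True = u).\<close>

type_synonym 'a fa = "bool list \<Rightarrow> 'a"

definition FA :: "('a::field) fa set" where
  "FA = {p. finite {w. p w \<noteq> 0}}"

definition fa_zero :: "('a::field) fa" where "fa_zero = (\<lambda>w. 0)"
definition fa_one :: "('a::field) fa" where "fa_one = (\<lambda>w. if w = [] then 1 else 0)"
definition fa_d :: "('a::field) fa" where "fa_d = (\<lambda>w. if w = [False] then 1 else 0)"
definition fa_u :: "('a::field) fa" where "fa_u = (\<lambda>w. if w = [True] then 1 else 0)"
definition fa_add :: "('a::field) fa \<Rightarrow> 'a fa \<Rightarrow> 'a fa" where
  "fa_add p q = (\<lambda>w. p w + q w)"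
definition fa_sub :: "('a::field) fa \<Rightarrow> 'a fa \<Rightarrow> 'a fa" where
  "fa_sub p q = (\<lambda>w. p w - q w)"
definition fa_smult :: "'a::field \<Rightarrow> 'a fa \<Rightarrow> 'a fa" where
  "fa_smult c p = (\<lambda>w. c * p w)"
definition fa_mult :: "('a::field) fa \<Rightarrow> 'a fa \<Rightarrow> 'a fa" where
  "fa_mult p q = (\<lambda>w. \<Sum>i\<le>length w. p (take i w) * q (drop i w))"

inductive_set fa_ideal :: "('a::field) fa set \<Rightarrow> 'a fa set" for S where
  gen: "s \<in> S \<Longrightarrow> s \<in> fa_ideal S"
| zero: "fa_zero \<in> fa_ideal S"
| add: "a \<in> fa_ideal S \<Longrightarrow> b \<in> fa_ideal S \<Longrightarrow> fa_add a b \<in> fa_ideal S"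
| mult: "a \<in> fa_ideal S \<Longrightarrow> p \<in> FA \<Longrightarrow> q \<in> FA \<Longrightarrow> fa_mult (fa_mult p a) q \<in> fa_ideal S"

definition du_rels :: "'a::field \<Rightarrow> 'a \<Rightarrow> 'a \<Rightarrow> 'a fa set" where
  "du_rels \<alpha> \<beta> \<gamma> =
    { fa_sub (fa_mult (fa_mult fa_d fa_d) fa_u)
        (fa_add (fa_add (fa_smult \<alpha> (fa_mult (fa_mult fa_d fa_u) fa_d))
                        (fa_smult \<beta> (fa_mult (fa_mult fa_u fa_d) fa_d)))
                (fa_smult \<gamma> fa_d)),
      fa_sub (fa_mult (fa_mult fa_d fa_u) fa_u)
        (fa_add (fa_add (fa_smult \<alpha> (fa_mult (fa_mult fa_u fa_d) fa_u))
                        (fa_smult \<beta> (fa_mult (fa_mult fa_u fa_u) fa_d)))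
                (fa_smult \<gamma> fa_u)) }"

definition du_ideal :: "'a::field \<Rightarrow> 'a \<Rightarrow> 'a \<Rightarrow> 'a fa set" where
  "du_ideal \<alpha> \<beta> \<gamma> = fa_ideal (du_rels \<alpha> \<beta> \<gamma>)"

definition qcls :: "('a::field) fa set \<Rightarrow> 'a fa \<Rightarrow> 'a fa set" where
  "qcls I p = {q \<in> FA. fa_sub p q \<in> I}"

definition qcarrier :: "('a::field) fa set \<Rightarrow> 'a fa set set" where
  "qcarrier I = qcls I ` FA"

definition qrep :: "('a::field) fa set \<Rightarrow> 'a fa" where
  "qrep C = (SOME p. p \<in> C)"

definition qadd :: "('a::field) fa set \<Rightarrow> 'a fa set \<Rightarrow> 'a fa set \<Rightarrow> 'a fa set" where
  "qadd I C D = qcls I (fa_add (qrep C) (qrep D))"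
definition qmult :: "('a::field) fa set \<Rightarrow> 'a fa set \<Rightarrow> 'a fa set \<Rightarrow> 'a fa set" where
  "qmult I C D = qcls I (fa_mult (qrep C) (qrep D))"
definition qsmult :: "('a::field) fa set \<Rightarrow> 'a \<Rightarrow> 'a fa set \<Rightarrow> 'a fa set" where
  "qsmult I c C = qcls I (fa_smult c (qrep C))"

definition qalg_iso :: "('a::field) fa set \<Rightarrow> 'a fa set \<Rightarrow> bool" where
  "qalg_iso I J \<longleftrightarrow> (\<exists>f. bij_betw f (qcarrier I) (qcarrier J)
     \<and> (\<forall>x\<in>qcarrier I. \<forall>y\<in>qcarrier I.
          f (qadd I x y) = qadd J (f x) (f y) \<and> f (qmult I x y) = qmult J (f x) (f y))
     \<and> (\<forall>c. \<forall>x\<in>qcarrier I. f (qsmult I c x) = qsmult J c (f x))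
     \<and> f (qcls I fa_one) = qcls J fa_one)"

definition down_up_iso :: "'a::field \<Rightarrow> 'a \<Rightarrow> 'a \<Rightarrow> 'a \<Rightarrow> 'a \<Rightarrow> 'a \<Rightarrow> bool" where
  "down_up_iso \<alpha> \<beta> \<gamma> \<alpha>' \<beta>' \<gamma>' = qalg_iso (du_ideal \<alpha> \<beta> \<gamma>) (du_ideal \<alpha>' \<beta>' \<gamma>')"

definition alg_closed :: "'a::field itself \<Rightarrow> bool" where
  "alg_closed _ \<longleftrightarrow> (\<forall>p :: 'a poly. degree p \<ge> 1 \<longrightarrow> (\<exists>x. poly p x = 0))"

end

theory Submission
  imports Defs
begin

text \<open>
An isomorphism pulls representations back, compatibly with subrepresentations and deformations, so
representations on polynomials are enough to tell the algebras apart. The one-dimensional representations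
\<open>d = a\<close>, \<open>u = b\<close> are the points with \<open>a\<^sup>2 b (1 - \<alpha>) = \<gamma> a\<close> and \<open>a b\<^sup>2 (1 - \<alpha>) = \<gamma> b\<close>:
a plane or two crossing lines for \<open>\<gamma> = 0\<close>, a reduced point or a reduced point together with the hyperbola
\<open>a b = s = \<gamma> / (1 - \<alpha>)\<close> for \<open>\<gamma> \<noteq> 0\<close>. The dimensions of the tangent spaces separate these four shapes,
so it remains to compare two values \<open>\<alpha>, \<alpha>' \<noteq> 1\<close> with \<open>\<gamma>, \<gamma>'\<close> both zero or both nonzero.

If \<open>\<gamma> = 0\<close>, the crossing point is fixed and the linear part of the isomorphism maps the cubic relations
to the cubic relations, which are tested on nilpotent \<open>4 \<times> 4\<close> matrices. The linear part must be diagonal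
or antidiagonal; the latter is impossible and the former gives \<open>\<alpha>' = \<alpha>\<close>.

If \<open>\<gamma> \<noteq> 0\<close>, the isomorphism induces \<open>t \<mapsto> c t\<close> or \<open>t \<mapsto> c / t\<close> on the hyperbola \<open>d = t\<close>, \<open>u = s / t\<close>.
The relations have a Toeplitz representation in which \<open>d u = s\<close> while \<open>u d \<noteq> s\<close>: an index-type argument,
sensitive to the direction of the shift, excludes \<open>t \<mapsto> c / t\<close>. Finally, two distinct points \<open>t\<^sub>1, t\<^sub>2\<close>
of the hyperbola have a nonsplit extension exactly if \<open>t\<^sub>1 = \<alpha> t\<^sub>2\<close>, so \<open>\<alpha>\<close> is an invariant.
\<close>

section \<open>The free algebra and its quotients\<close>

definition supp :: "'a::field fa \<Rightarrow> bool list set" where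
  "supp p = {w. p w \<noteq> 0}"

lemma FA_iff: "p \<in> FA \<longleftrightarrow> finite (supp p)"
  by (simp add: FA_def supp_def)

lemma fa_zero_FA [simp]: "fa_zero \<in> FA"
  and fa_one_FA [simp]: "fa_one \<in> FA"
  and fa_d_FA [simp]: "fa_d \<in> FA"
  and fa_u_FA [simp]: "fa_u \<in> FA"
  by (simp_all add: FA_def fa_zero_def fa_one_def fa_d_def fa_u_def)

lemma fa_add_FA [simp]: "p \<in> FA \<Longrightarrow> q \<in> FA \<Longrightarrow> fa_add p q \<in> FA"
  unfolding FA_iff by (erule (1) finite_subset[OF _ finite_UnI, rotated]) (auto simp: supp_def fa_add_def)

lemma fa_sub_FA [simp]: "p \<in> FA \<Longrightarrow> q \<in> FA \<Longrightarrow> fa_sub p q \<in> FA"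
  unfolding FA_iff by (erule (1) finite_subset[OF _ finite_UnI, rotated]) (auto simp: supp_def fa_sub_def)

lemma fa_smult_FA [simp]: "p \<in> FA \<Longrightarrow> fa_smult c p \<in> FA"
  unfolding FA_iff by (erule finite_subset[rotated]) (auto simp: supp_def fa_smult_def)

lemma supp_fa_mult: "supp (fa_mult p q) \<subseteq> (\<lambda>(v, v'). v @ v') ` (supp p \<times> supp q)"
proof
  fix w assume "w \<in> supp (fa_mult p q)"
  then obtain i where "p (take i w) * q (drop i w) \<noteq> 0"
    unfolding supp_def fa_mult_def by (auto elim: sum.not_neutral_contains_not_neutral)
  then have "(take i w, drop i w) \<in> supp p \<times> supp q" by (auto simp: supp_def)
  then show "w \<in> (\<lambda>(v, v'). v @ v') ` (supp p \<times> supp q)"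
    by (rule rev_image_eqI) simp
qed

lemma fa_mult_FA [simp]: "p \<in> FA \<Longrightarrow> q \<in> FA \<Longrightarrow> fa_mult p q \<in> FA"
  unfolding FA_iff by (rule finite_subset[OF supp_fa_mult]) simp

lemma fa_mult_one_left [simp]: "fa_mult fa_one p = p"
proof
  fix w
  have "fa_mult fa_one p w = (\<Sum>i\<le>length w. if i = 0 then p w else 0)"
    unfolding fa_mult_def by (rule sum.cong) (auto simp: fa_one_def)
  then show "fa_mult fa_one p w = p w" by simp
qed

lemma fa_mult_one_right [simp]: "fa_mult p fa_one = p"
proof
  fix w
  have "fa_mult p fa_one w = (\<Sum>i\<le>length w. if i = length w then p w else 0)"
    unfolding fa_mult_def by (rule sum.cong) (auto simp: fa_one_def)
  then show "fa_mult p fa_one w = p w" by simp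
qed

lemma fa_mult_smult_left: "fa_mult (fa_smult c p) q = fa_smult c (fa_mult p q)"
  by (rule ext) (simp add: fa_mult_def fa_smult_def sum_distrib_left mult.assoc)

lemma fa_mult_sub_left: "fa_mult (fa_sub p p') q = fa_sub (fa_mult p q) (fa_mult p' q)"
  and fa_mult_sub_right: "fa_mult q (fa_sub p p') = fa_sub (fa_mult q p) (fa_mult q p')"
  by (rule ext, simp add: fa_mult_def fa_sub_def algebra_simps sum_subtractf)+

lemma fa_mult_Cons:
  "fa_mult fa_d p w = (case w of [] \<Rightarrow> 0 | l # v \<Rightarrow> if l then 0 else p v)"
  "fa_mult fa_u p w = (case w of [] \<Rightarrow> 0 | l # v \<Rightarrow> if l then p v else 0)"
proof -
  have *: "(\<Sum>i\<le>length w. (if take i w = [b] then 1 else 0) * p (drop i w))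
      = (case w of [] \<Rightarrow> 0 | l # v \<Rightarrow> if l = b then p v else 0)" for b :: bool
  proof (cases w)
    case (Cons l v)
    have "(\<Sum>i\<le>length w. (if take i w = [b] then 1 else 0) * p (drop i w))
        = (\<Sum>i\<le>length w. if i = 1 then (if l = b then p v else 0) else 0)"
      by (rule sum.cong) (auto simp: Cons take_Cons split: nat.splits)
    also have "\<dots> = (if l = b then p v else 0)"
      by (subst sum.delta) (auto simp: Cons)
    finally show ?thesis by (simp add: Cons)
  qed simp
  show "fa_mult fa_d p w = (case w of [] \<Rightarrow> 0 | l # v \<Rightarrow> if l then 0 else p v)"
    using *[of False] by (simp add: fa_mult_def fa_d_def split: list.splits)
  show "fa_mult fa_u p w = (case w of [] \<Rightarrow> 0 | l # v \<Rightarrow> if l then p v else 0)"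
    using *[of True] by (simp add: fa_mult_def fa_u_def split: list.splits)
qed

text \<open>Every word arises from the unit by left multiplication with letters, and every element
  is a finite combination of words. The rule later identifies an algebra homomorphism with
  evaluation at the images of the generators.\<close>

lemma FA_induct [consumes 1, case_names one d u smult add]:
  assumes "p \<in> FA"
    and one: "P fa_one"
    and d: "\<And>p. p \<in> FA \<Longrightarrow> P p \<Longrightarrow> P (fa_mult fa_d p)"
    and u: "\<And>p. p \<in> FA \<Longrightarrow> P p \<Longrightarrow> P (fa_mult fa_u p)"
    and smult: "\<And>c p. p \<in> FA \<Longrightarrow> P p \<Longrightarrow> P (fa_smult c p)"
    and add: "\<And>p q. p \<in> FA \<Longrightarrow> q \<in> FA \<Longrightarrow> P p \<Longrightarrow> P q \<Longrightarrow> P (fa_add p q)"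
  shows "P p"
proof -
  define word :: "bool list \<Rightarrow> 'a fa" where "word v = (\<lambda>w. if w = v then 1 else 0)" for v
  have word_FA: "word v \<in> FA" for v by (simp add: FA_def word_def)
  have word: "P (word v)" for v
  proof (induction v)
    case Nil
    then show ?case using one by (simp add: word_def fa_one_def)
  next
    case (Cons l v)
    have "word (l # v) = fa_mult (if l then fa_u else fa_d) (word v)"
      by (rule ext) (auto simp: word_def fa_mult_Cons split: list.splits)
    then show ?case using Cons d[OF word_FA] u[OF word_FA] by (cases l) auto
  qed
  have "finite A \<Longrightarrow> supp p = A \<Longrightarrow> P p" for A p
  proof (induction A arbitrary: p rule: finite_induct)
    case empty
    \<comment> \<open>The rule has no case for zero, which is reached as the zero multiple of the
      unit.\<close>
    then have "p = fa_smult 0 fa_one" by (auto simp: supp_def fa_smult_def)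
    then show ?case using one smult[OF fa_one_FA] by simp
  next
    case (insert v A)
    define q where "q = p(v := 0)"
    have q: "supp q = A" using insert by (auto simp: supp_def q_def)
    have "p = fa_add (fa_smult (p v) (word v)) q"
      by (rule ext) (auto simp: fa_add_def fa_smult_def word_def q_def)
    moreover have "P (fa_smult (p v) (word v))" using word word_FA smult by blast
    moreover have "P q" using insert q by blast
    moreover have "q \<in> FA" using q insert by (simp add: FA_iff)
    ultimately show ?case using add[OF fa_smult_FA[OF word_FA]] by metis
  qed
  then show ?thesis using assms(1) by (simp add: FA_iff)
qed

section \<open>Two-sided ideals and arithmetic of residue classes\<close>

locale fa_ideal_set =
  fixes I :: "'a::field fa set"
  assumes subset_FA: "I \<subseteq> FA"
    and zero_mem: "fa_zero \<in> I"
    and add_mem: "a \<in> I \<Longrightarrow> b \<in> I \<Longrightarrow> fa_add a b \<in> I"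
    and mult_mem: "a \<in> I \<Longrightarrow> p \<in> FA \<Longrightarrow> q \<in> FA \<Longrightarrow> fa_mult (fa_mult p a) q \<in> I"
begin

lemma smult_mem: "a \<in> I \<Longrightarrow> fa_smult c a \<in> I"
  using mult_mem[of a "fa_smult c fa_one" fa_one] by (simp add: fa_mult_smult_left)

lemma sub_refl: "fa_sub p p \<in> I"
  using zero_mem by (simp add: fa_sub_def fa_zero_def)

lemma sub_sym: "fa_sub p q \<in> I \<Longrightarrow> fa_sub q p \<in> I"
  using smult_mem[of "fa_sub p q" "-1"] by (simp add: fa_sub_def fa_smult_def)

lemma sub_trans: "fa_sub p q \<in> I \<Longrightarrow> fa_sub q r \<in> I \<Longrightarrow> fa_sub p r \<in> I"
  using add_mem[of "fa_sub p q" "fa_sub q r"] by (simp add: fa_sub_def fa_add_def)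

lemma qcls_eq_iff:
  assumes "p \<in> FA" "q \<in> FA"
  shows "qcls I p = qcls I q \<longleftrightarrow> fa_sub p q \<in> I"
  using assms sub_refl sub_sym sub_trans unfolding qcls_def by blast

lemma qrep_qcls:
  assumes "p \<in> FA"
  shows "qrep (qcls I p) \<in> FA" and "fa_sub p (qrep (qcls I p)) \<in> I"
proof -
  have "p \<in> qcls I p" using assms sub_refl by (simp add: qcls_def)
  then have "qrep (qcls I p) \<in> qcls I p" unfolding qrep_def by (rule someI[where P = "\<lambda>r. r \<in> qcls I p"])
  then show "qrep (qcls I p) \<in> FA" and "fa_sub p (qrep (qcls I p)) \<in> I" by (auto simp: qcls_def)
qed

lemma qcls_qrep: "C \<in> qcarrier I \<Longrightarrow> qcls I (qrep C) = C"
  and qrep_FA: "C \<in> qcarrier I \<Longrightarrow> qrep C \<in> FA"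
  unfolding qcarrier_def using qrep_qcls qcls_eq_iff sub_sym by fastforce+

lemma qadd_qcls:
  assumes "p \<in> FA" "q \<in> FA"
  shows "qadd I (qcls I p) (qcls I q) = qcls I (fa_add p q)"
proof -
  let ?p = "qrep (qcls I p)" and ?q = "qrep (qcls I q)"
  have "fa_sub (fa_add p q) (fa_add ?p ?q) = fa_add (fa_sub p ?p) (fa_sub q ?q)"
    by (simp add: fa_sub_def fa_add_def algebra_simps)
  then have "fa_sub (fa_add p q) (fa_add ?p ?q) \<in> I"
    using add_mem qrep_qcls assms by simp
  then show ?thesis unfolding qadd_def using qcls_eq_iff qrep_qcls assms by (metis fa_add_FA)
qed

lemma qmult_qcls:
  assumes "p \<in> FA" "q \<in> FA"
  shows "qmult I (qcls I p) (qcls I q) = qcls I (fa_mult p q)"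
proof -
  let ?p = "qrep (qcls I p)" and ?q = "qrep (qcls I q)"
  \<comment> \<open>The splitting \<open>p q - p' q' = (p - p') q + p' (q - q')\<close>; the units
    bring both terms into the form of \<open>mult_mem\<close>.\<close>
  have "fa_sub (fa_mult p q) (fa_mult ?p ?q)
      = fa_add (fa_mult (fa_mult fa_one (fa_sub p ?p)) q) (fa_mult (fa_mult ?p (fa_sub q ?q)) fa_one)"
    by (simp add: fa_mult_sub_left fa_mult_sub_right) (simp add: fa_sub_def fa_add_def algebra_simps)
  then have "fa_sub (fa_mult p q) (fa_mult ?p ?q) \<in> I"
    using add_mem[OF mult_mem[OF _ fa_one_FA] mult_mem[OF _ _ fa_one_FA]] qrep_qcls assms by metis
  then show ?thesis unfolding qmult_def using qcls_eq_iff qrep_qcls assms by (metis fa_mult_FA)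
qed

lemma qsmult_qcls:
  assumes "p \<in> FA"
  shows "qsmult I c (qcls I p) = qcls I (fa_smult c p)"
proof -
  let ?p = "qrep (qcls I p)"
  have "fa_sub (fa_smult c p) (fa_smult c ?p) = fa_smult c (fa_sub p ?p)"
    by (simp add: fa_sub_def fa_smult_def algebra_simps)
  then have "fa_sub (fa_smult c p) (fa_smult c ?p) \<in> I"
    using smult_mem qrep_qcls assms by simp
  then show ?thesis unfolding qsmult_def using qcls_eq_iff qrep_qcls assms by (metis fa_smult_FA)
qed

end

lemma fa_ideal_set_fa_ideal:
  assumes "S \<subseteq> FA"
  shows "fa_ideal_set (fa_ideal S)"
proof
  have "a \<in> FA" if "a \<in> fa_ideal S" for a
    using that by induction (use assms in auto)
  then show "fa_ideal S \<subseteq> FA" by blast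
qed (auto intro: fa_ideal.intros)

lemma du_rels_FA: "du_rels \<alpha> \<beta> \<gamma> \<subseteq> FA"
  by (simp add: du_rels_def)

lemma fa_ideal_set_du_ideal: "fa_ideal_set (du_ideal \<alpha> \<beta> \<gamma>)"
  unfolding du_ideal_def by (rule fa_ideal_set_fa_ideal[OF du_rels_FA])

section \<open>Homomorphisms of quotient algebras\<close>

definition qalg_hom :: "('a::field fa set \<Rightarrow> 'a fa set) \<Rightarrow> 'a fa set \<Rightarrow> 'a fa set \<Rightarrow> bool" where
  "qalg_hom f I J \<longleftrightarrow> f ` qcarrier I \<subseteq> qcarrier J
     \<and> (\<forall>x\<in>qcarrier I. \<forall>y\<in>qcarrier I.
          f (qadd I x y) = qadd J (f x) (f y) \<and> f (qmult I x y) = qmult J (f x) (f y))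
     \<and> (\<forall>c. \<forall>x\<in>qcarrier I. f (qsmult I c x) = qsmult J c (f x))
     \<and> f (qcls I fa_one) = qcls J fa_one"

lemma qcls_mem_qcarrier: "p \<in> FA \<Longrightarrow> qcls I p \<in> qcarrier I"
  by (simp add: qcarrier_def)

lemma qops_mem_qcarrier:
  assumes "fa_ideal_set I" "x \<in> qcarrier I" "y \<in> qcarrier I"
  shows "qadd I x y \<in> qcarrier I" "qmult I x y \<in> qcarrier I" "qsmult I c x \<in> qcarrier I"
  using assms unfolding qadd_def qmult_def qsmult_def
  by (auto intro!: qcls_mem_qcarrier simp: fa_ideal_set.qrep_FA)

lemma qalg_iso_imp_inverse_homs:
  assumes "qalg_iso I J" "fa_ideal_set I" "fa_ideal_set J"
  obtains f g where "qalg_hom f I J" "qalg_hom g J I"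
    "\<And>x. x \<in> qcarrier I \<Longrightarrow> g (f x) = x" "\<And>y. y \<in> qcarrier J \<Longrightarrow> f (g y) = y"
proof -
  from assms(1) obtain f where bij: "bij_betw f (qcarrier I) (qcarrier J)"
    and f: "\<forall>x\<in>qcarrier I. \<forall>y\<in>qcarrier I.
          f (qadd I x y) = qadd J (f x) (f y) \<and> f (qmult I x y) = qmult J (f x) (f y)"
      "\<forall>c. \<forall>x\<in>qcarrier I. f (qsmult I c x) = qsmult J c (f x)"
      "f (qcls I fa_one) = qcls J fa_one"
    unfolding qalg_iso_def by blast
  define g where "g = inv_into (qcarrier I) f"
  have gf: "g (f x) = x" if "x \<in> qcarrier I" for x
    using that bij by (simp add: g_def bij_betw_inv_into_left)
  have fg: "f (g y) = y" if "y \<in> qcarrier J" for y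
    using that bij by (simp add: g_def bij_betw_inv_into_right)
  have g_mem: "g y \<in> qcarrier I" if "y \<in> qcarrier J" for y
    using that bij unfolding g_def by (metis bij_betw_apply bij_betw_inv_into)
  have "qalg_hom f I J" using f bij by (auto simp: qalg_hom_def bij_betw_def)
  moreover have "qalg_hom g J I"
    unfolding qalg_hom_def
  proof (intro conjI ballI allI)
    show "g ` qcarrier J \<subseteq> qcarrier I" using g_mem by blast
    show "g (qcls J fa_one) = qcls I fa_one"
      using gf[of "qcls I fa_one"] f(3) by (simp add: qcls_mem_qcarrier)
  next
    fix x y assume xy: "x \<in> qcarrier J" "y \<in> qcarrier J"
    show "g (qadd J x y) = qadd I (g x) (g y)"
      using gf[of "qadd I (g x) (g y)"] f(1) g_mem xy fg qops_mem_qcarrier[OF assms(2)] by simp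
    show "g (qmult J x y) = qmult I (g x) (g y)"
      using gf[of "qmult I (g x) (g y)"] f(1) g_mem xy fg qops_mem_qcarrier[OF assms(2)] by simp
  next
    fix c x assume x: "x \<in> qcarrier J"
    show "g (qsmult J c x) = qsmult I c (g x)"
      using gf[of "qsmult I c (g x)"] f(2) g_mem x fg qops_mem_qcarrier(3)[OF assms(2), of "g x" "g x"]
      by simp
  qed
  ultimately show ?thesis using that gf fg by blast
qed

section \<open>Rescaling a generator\<close>

text \<open>The endomorphism of the free algebra that fixes \<open>d\<close> and substitutes
  \<open>c u\<close> for \<open>u\<close>.\<close>

definition rescale :: "'a::field \<Rightarrow> 'a fa \<Rightarrow> 'a fa" where
  "rescale c p = (\<lambda>w. c ^ count_list w True * p w)"

lemma rescale_FA [simp]: "p \<in> FA \<Longrightarrow> rescale c p \<in> FA"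
  unfolding FA_iff by (erule finite_subset[rotated]) (auto simp: supp_def rescale_def)

lemma rescale_hom:
  "rescale c fa_zero = fa_zero" "rescale c fa_one = fa_one"
  "rescale c fa_d = fa_d" "rescale c fa_u = fa_smult c fa_u"
  "rescale c (fa_add p q) = fa_add (rescale c p) (rescale c q)"
  "rescale c (fa_sub p q) = fa_sub (rescale c p) (rescale c q)"
  "rescale c (fa_smult k p) = fa_smult k (rescale c p)"
  by (rule ext, simp add: rescale_def fa_zero_def fa_one_def fa_d_def fa_u_def fa_add_def fa_sub_def
      fa_smult_def algebra_simps)+

lemma rescale_mult: "rescale c (fa_mult p q) = fa_mult (rescale c p) (rescale c q)"
proof
  fix w
  have "c ^ count_list w True = c ^ count_list (take i w) True * c ^ count_list (drop i w) True" for i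
    by (metis append_take_drop_id count_list_append power_add)
  then show "rescale c (fa_mult p q) w = fa_mult (rescale c p) (rescale c q) w"
    unfolding rescale_def fa_mult_def sum_distrib_left
    by (intro sum.cong) (auto simp: mult_ac)
qed

lemma rescale_inverse: "c \<noteq> 0 \<Longrightarrow> rescale (inverse c) (rescale c p) = p"
  by (rule ext) (simp add: rescale_def flip: mult.assoc power_mult_distrib)

text \<open>In each relation the linear term has one letter \<open>u\<close> fewer than the cubic
  terms, and the factor \<open>c\<close> in the source parameter makes up for it: the two relations
  go to \<open>c\<close> and \<open>c * c\<close> times the target relations.\<close>

lemma rescale_du_ideal:
  assumes "c \<noteq> 0" and "a \<in> du_ideal \<alpha> 0 (c * \<gamma>)"
  shows "rescale c a \<in> du_ideal \<alpha> 0 \<gamma>"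
  using assms(2) unfolding du_ideal_def
proof induction
  case (gen s)
  interpret fa_ideal_set "fa_ideal (du_rels \<alpha> 0 \<gamma>)"
    by (rule fa_ideal_set_fa_ideal[OF du_rels_FA])
  obtain r k where "r \<in> du_rels \<alpha> 0 \<gamma>" "rescale c s = fa_smult k r"
  proof -
    have *: "fa_mult p (fa_smult k q) = fa_smult k (fa_mult p q)" for k p q
      by (rule ext) (simp add: fa_mult_def fa_smult_def sum_distrib_left mult_ac)
    consider "s = fa_sub (fa_mult (fa_mult fa_d fa_d) fa_u)
        (fa_add (fa_add (fa_smult \<alpha> (fa_mult (fa_mult fa_d fa_u) fa_d))
                        (fa_smult 0 (fa_mult (fa_mult fa_u fa_d) fa_d)))
                (fa_smult (c * \<gamma>) fa_d))"
      | "s = fa_sub (fa_mult (fa_mult fa_d fa_u) fa_u)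
        (fa_add (fa_add (fa_smult \<alpha> (fa_mult (fa_mult fa_u fa_d) fa_u))
                        (fa_smult 0 (fa_mult (fa_mult fa_u fa_u) fa_d)))
                (fa_smult (c * \<gamma>) fa_u))"
      using gen unfolding du_rels_def by blast
    then show ?thesis
    proof cases
      case 1
      show ?thesis
        by (rule that[of "fa_sub (fa_mult (fa_mult fa_d fa_d) fa_u)
        (fa_add (fa_add (fa_smult \<alpha> (fa_mult (fa_mult fa_d fa_u) fa_d))
                        (fa_smult 0 (fa_mult (fa_mult fa_u fa_d) fa_d)))
                (fa_smult \<gamma> fa_d))" c])
          (simp add: du_rels_def,
           simp add: 1 rescale_hom rescale_mult fa_mult_smult_left *,
           simp add: fa_sub_def fa_add_def fa_smult_def algebra_simps)
    next
      case 2
      show ?thesis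
        by (rule that[of "fa_sub (fa_mult (fa_mult fa_d fa_u) fa_u)
        (fa_add (fa_add (fa_smult \<alpha> (fa_mult (fa_mult fa_u fa_d) fa_u))
                        (fa_smult 0 (fa_mult (fa_mult fa_u fa_u) fa_d)))
                (fa_smult \<gamma> fa_u))" "c * c"])
          (simp add: du_rels_def,
           simp add: 2 rescale_hom rescale_mult fa_mult_smult_left *,
           simp add: fa_sub_def fa_add_def fa_smult_def algebra_simps)
    qed
  qed
  then show ?case using smult_mem fa_ideal.gen by metis
qed (auto simp: rescale_hom rescale_mult intro: fa_ideal.intros)

lemma down_up_iso_rescale:
  assumes c: "c \<noteq> 0"
  shows "down_up_iso \<alpha> 0 (c * \<gamma>) \<alpha> 0 \<gamma>"
proof -
  let ?I = "du_ideal \<alpha> 0 (c * \<gamma>)" and ?J = "du_ideal \<alpha> 0 \<gamma>"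
  interpret I: fa_ideal_set ?I by (rule fa_ideal_set_du_ideal)
  interpret J: fa_ideal_set ?J by (rule fa_ideal_set_du_ideal)
  define f where "f C = qcls ?J (rescale c (qrep C))" for C
  \<comment> \<open>The inverse substitution is the same lemma with factor \<open>inverse c\<close>
    and parameter \<open>c * \<gamma>\<close>.\<close>
  have mem_back: "rescale (inverse c) a \<in> ?I" if "a \<in> ?J" for a
    using rescale_du_ideal[of "inverse c" a \<alpha> "c * \<gamma>"] that c by (simp flip: mult.assoc)
  have mem: "rescale c a \<in> ?J \<longleftrightarrow> a \<in> ?I" for a
    using rescale_du_ideal[OF c] mem_back[of "rescale c a"] rescale_inverse[OF c] by metis
  have eq: "qcls ?J (rescale c p) = qcls ?J (rescale c q) \<longleftrightarrow> qcls ?I p = qcls ?I q"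
    if "p \<in> FA" "q \<in> FA" for p q
    using that by (simp add: I.qcls_eq_iff J.qcls_eq_iff mem flip: rescale_hom)
  have f: "f (qcls ?I p) = qcls ?J (rescale c p)" if "p \<in> FA" for p
    unfolding f_def using that I.qrep_qcls I.qcls_qrep
    by (subst eq) (simp_all add: qcls_mem_qcarrier)
  have "bij_betw f (qcarrier ?I) (qcarrier ?J)"
    unfolding bij_betw_def
  proof
    show "inj_on f (qcarrier ?I)"
      by (auto simp: inj_on_def qcarrier_def f eq)
    have "qcls ?J p \<in> f ` qcarrier ?I" if "p \<in> FA" for p
    proof
      show "qcls ?J p = f (qcls ?I (rescale (inverse c) p))"
        using rescale_inverse[of "inverse c" p] that c by (simp add: f)
    qed (use that in \<open>simp add: qcls_mem_qcarrier\<close>)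
    then show "f ` qcarrier ?I = qcarrier ?J"
      by (auto simp: qcarrier_def f)
  qed
  moreover have "f (qadd ?I x y) = qadd ?J (f x) (f y) \<and> f (qmult ?I x y) = qmult ?J (f x) (f y)"
    if "x \<in> qcarrier ?I" "y \<in> qcarrier ?I" for x y
    using that unfolding qcarrier_def
    by (auto simp: f I.qadd_qcls J.qadd_qcls I.qmult_qcls J.qmult_qcls rescale_hom rescale_mult)
  moreover have "f (qsmult ?I k x) = qsmult ?J k (f x)" if "x \<in> qcarrier ?I" for k x
    using that unfolding qcarrier_def
    by (auto simp: f I.qsmult_qcls J.qsmult_qcls rescale_hom)
  moreover have "f (qcls ?I fa_one) = qcls ?J fa_one"
    by (simp add: f rescale_hom)
  ultimately show ?thesis unfolding down_up_iso_def qalg_iso_def by blast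
qed

section \<open>Representations on polynomials\<close>

text \<open>One vector space carries all modules: the low coefficients show the finite-dimensional
  phenomena, and the shift module uses the whole space.\<close>

type_synonym 'a op = "'a poly \<Rightarrow> 'a poly"

definition lin :: "'a::field op \<Rightarrow> bool" where
  "lin T \<longleftrightarrow> (\<forall>x y. T (x + y) = T x + T y) \<and> (\<forall>c x. T (smult c x) = smult c (T x))"

lemma lin_add: "lin T \<Longrightarrow> T (x + y) = T x + T y"
  and lin_smult: "lin T \<Longrightarrow> T (smult c x) = smult c (T x)"
  by (simp_all add: lin_def)

lemma lin_zero: "lin T \<Longrightarrow> T 0 = 0"
  using lin_smult[of T 0 0] by simp

lemma lin_diff: "lin T \<Longrightarrow> T (x - y) = T x - T y"
  using lin_add[of T "x - y" y] by simp

lemma lin_sum: "lin T \<Longrightarrow> T (\<Sum>i\<in>A. g i) = (\<Sum>i\<in>A. T (g i))"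
  by (induction A rule: infinite_finite_induct) (simp_all add: lin_zero lin_add)

lemma smult_sum_right: "smult c (\<Sum>i\<in>A. g i) = (\<Sum>i\<in>A. smult c (g i))"
  for c :: "'a::field"
  by (rule lin_sum) (simp add: lin_def smult_add_right mult.commute)

definition subsp :: "'a::field poly set \<Rightarrow> bool" where
  "subsp S \<longleftrightarrow> 0 \<in> S \<and> (\<forall>x\<in>S. \<forall>y\<in>S. x + y \<in> S) \<and> (\<forall>c. \<forall>x\<in>S. smult c x \<in> S)"

lemma subsp_sum: "subsp S \<Longrightarrow> (\<And>i. i \<in> A \<Longrightarrow> g i \<in> S) \<Longrightarrow> (\<Sum>i\<in>A. g i) \<in> S"
  by (induction A rule: infinite_finite_induct) (simp_all add: subsp_def)

fun act :: "'a op \<Rightarrow> 'a op \<Rightarrow> bool list \<Rightarrow> 'a op" where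
  "act D U [] x = x"
| "act D U (l # w) x = (if l then U else D) (act D U w x)"

definition ev :: "'a::field op \<Rightarrow> 'a op \<Rightarrow> 'a fa \<Rightarrow> 'a op" where
  "ev D U p x = (\<Sum>w\<in>supp p. smult (p w) (act D U w x))"

text \<open>The character of the free algebra that takes the value \<open>a\<close> at
  \<open>d\<close> and \<open>b\<close> at \<open>u\<close>.\<close>

definition chi :: "'a::field \<Rightarrow> 'a \<Rightarrow> 'a fa \<Rightarrow> 'a" where
  "chi a b p = (\<Sum>w\<in>supp p. p w * prod_list (map (\<lambda>l. if l then b else a) w))"

lemma act_append: "act D U (v @ w) x = act D U v (act D U w x)"
  by (induction v) auto

lemma lin_act: "lin D \<Longrightarrow> lin U \<Longrightarrow> lin (act D U w)"
  by (induction w) (auto simp: lin_def)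

lemma ev_superset:
  assumes "finite A" "supp p \<subseteq> A"
  shows "ev D U p x = (\<Sum>w\<in>A. smult (p w) (act D U w x))"
  unfolding ev_def using assms by (intro sum.mono_neutral_left) (auto simp: supp_def)

lemma lin_ev:
  assumes "lin D" "lin U"
  shows "lin (ev D U p)"
  unfolding lin_def ev_def using lin_act[OF assms]
  by (auto simp: lin_add lin_smult smult_add_right sum.distrib smult_sum_right mult.commute)

lemma ev_add:
  assumes "p \<in> FA" "q \<in> FA"
  shows "ev D U (fa_add p q) x = ev D U p x + ev D U q x"
proof -
  let ?A = "supp p \<union> supp q"
  have "finite ?A" using assms by (simp add: FA_iff)
  moreover have "supp (fa_add p q) \<subseteq> ?A" by (auto simp: supp_def fa_add_def)
  ultimately show ?thesis
    by (simp add: ev_superset[of ?A] fa_add_def smult_add_left sum.distrib)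
qed

lemma ev_smult:
  assumes "p \<in> FA"
  shows "ev D U (fa_smult c p) x = smult c (ev D U p x)"
proof -
  have "supp (fa_smult c p) \<subseteq> supp p" by (auto simp: supp_def fa_smult_def)
  then show ?thesis using assms
    by (simp add: ev_superset[of "supp p"] FA_iff smult_sum_right fa_smult_def)
qed

lemma ev_sub:
  assumes "p \<in> FA" "q \<in> FA"
  shows "ev D U (fa_sub p q) x = ev D U p x - ev D U q x"
proof -
  have "fa_sub p q = fa_add p (fa_smult (-1) q)" by (simp add: fa_sub_def fa_add_def fa_smult_def)
  then show ?thesis using assms by (simp add: ev_add ev_smult)
qed

lemma ev_zero: "ev D U fa_zero x = 0"
  by (simp add: ev_def supp_def fa_zero_def)

lemma ev_word: "ev D U (\<lambda>w. if w = v then 1 else 0) x = act D U v x"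
  by (simp add: ev_def supp_def)

lemma ev_one: "ev D U fa_one x = x"
  and ev_d: "ev D U fa_d x = D x"
  and ev_u: "ev D U fa_u x = U x"
  unfolding fa_one_def fa_d_def fa_u_def ev_word by simp_all

lemma ev_mult:
  assumes "p \<in> FA" "q \<in> FA" "lin D" "lin U"
  shows "ev D U (fa_mult p q) x = ev D U p (ev D U q x)"
proof -
  let ?W = "(\<lambda>(v, v'). v @ v') ` (supp p \<times> supp q)"
  let ?f = "\<lambda>(v, v'). smult (p v * q v') (act D U (v @ v') x)"
  \<comment> \<open>A pair of words amounts to its concatenation together with the place of the cut.
    Cuts outside the two supports contribute zero.\<close>
  let ?j = "\<lambda>(v, v' :: bool list). (v @ v', length v)"
  have fin: "finite (supp p)" "finite (supp q)" using assms by (simp_all add: FA_iff)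
  have "ev D U (fa_mult p q) x = (\<Sum>w\<in>?W. smult (fa_mult p q w) (act D U w x))"
    using fin by (intro ev_superset supp_fa_mult) simp
  also have "\<dots> = (\<Sum>w\<in>?W. \<Sum>i\<le>length w. ?f (take i w, drop i w))"
    by (simp add: fa_mult_def smult_sum)
  also have "\<dots> = (\<Sum>(w, i)\<in>Sigma ?W (\<lambda>w. {..length w}). ?f (take i w, drop i w))"
    using fin by (intro sum.Sigma) auto
  also have "\<dots> = (\<Sum>(w, i)\<in>?j ` (supp p \<times> supp q). ?f (take i w, drop i w))"
  proof (rule sum.mono_neutral_right)
    show "finite (Sigma ?W (\<lambda>w. {..length w}))" using fin by auto
    show "?j ` (supp p \<times> supp q) \<subseteq> Sigma ?W (\<lambda>w. {..length w})" by auto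
    show "\<forall>z\<in>Sigma ?W (\<lambda>w. {..length w}) - ?j ` (supp p \<times> supp q).
        (case z of (w, i) \<Rightarrow> ?f (take i w, drop i w)) = 0"
    proof
      fix z assume z: "z \<in> Sigma ?W (\<lambda>w. {..length w}) - ?j ` (supp p \<times> supp q)"
      obtain w i where wi: "z = (w, i)" by (cases z)
      then have "z = ?j (take i w, drop i w)" using z by simp
      then have "(take i w, drop i w) \<notin> supp p \<times> supp q" using z by blast
      then show "(case z of (w, i) \<Rightarrow> ?f (take i w, drop i w)) = 0" by (auto simp: wi supp_def)
    qed
  qed
  also have "\<dots> = (\<Sum>z\<in>supp p \<times> supp q. ?f z)"
    by (subst sum.reindex) (auto simp: inj_on_def intro!: sum.cong)
  also have "\<dots> = (\<Sum>v\<in>supp p. \<Sum>v'\<in>supp q. smult (p v * q v') (act D U (v @ v') x))"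
    by (simp add: sum.cartesian_product)
  also have "\<dots> = ev D U p (ev D U q x)"
    unfolding ev_def lin_sum[OF lin_act[OF assms(3,4)]] lin_smult[OF lin_act[OF assms(3,4)]]
    by (simp add: act_append smult_sum_right)
  finally show ?thesis .
qed

lemma ev_closed:
  assumes "subsp S" "\<And>x. x \<in> S \<Longrightarrow> D x \<in> S" "\<And>x. x \<in> S \<Longrightarrow> U x \<in> S" "x \<in> S"
  shows "ev D U p x \<in> S"
proof -
  have "act D U w x \<in> S" for w using assms(2-4) by (induction w) auto
  then show ?thesis unfolding ev_def using assms(1) by (intro subsp_sum) (auto simp: subsp_def)
qed

lemma ev_commute:
  assumes "lin T" "\<And>x. T (D x) = D (T x)" "\<And>x. T (U x) = U (T x)"
  shows "T (ev D U p x) = ev D U p (T x)"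
proof -
  have "T (act D U w x) = act D U w (T x)" for w using assms(2,3) by (induction w) auto
  then show ?thesis by (simp add: ev_def lin_sum[OF assms(1)] lin_smult[OF assms(1)])
qed

text \<open>Modulo the submodule \<open>S\<close> the vector \<open>v\<close> is a joint
  eigenvector, so the free algebra acts on it there through a character. \<open>S = {0}\<close>
  gives eigenvectors, the constants give extensions of two characters.\<close>

lemma ev_eigenvector_mod:
  assumes "subsp S" "lin D" "lin U" "\<And>x. x \<in> S \<Longrightarrow> D x \<in> S" "\<And>x. x \<in> S \<Longrightarrow> U x \<in> S"
    and "D v - smult a v \<in> S" "U v - smult b v \<in> S"
  shows "ev D U p v - smult (chi a b p) v \<in> S"
proof -
  let ?m = "\<lambda>w. prod_list (map (\<lambda>l. if l then b else a) w)"
  have *: "act D U w v - smult (?m w) v \<in> S" for w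
  proof (induction w)
    case Nil
    then show ?case using assms(1) by (simp add: subsp_def)
  next
    case (Cons l w)
    let ?T = "if l then U else D" and ?c = "if l then b else a"
    have "act D U (l # w) v - smult (?m (l # w)) v
        = ?T (act D U w v - smult (?m w) v) + smult (?m w) (?T v - smult ?c v)"
      using assms(2,3) by (simp add: lin_diff lin_smult smult_diff_right mult.commute)
    moreover have "?T (act D U w v - smult (?m w) v) \<in> S" using Cons assms(4,5) by simp
    moreover have "smult (?m w) (?T v - smult ?c v) \<in> S" using assms(1,6,7) by (simp add: subsp_def)
    ultimately show ?case using assms(1) by (simp add: subsp_def)
  qed
  have "ev D U p v - smult (chi a b p) v = (\<Sum>w\<in>supp p. smult (p w) (act D U w v - smult (?m w) v))"
    by (simp add: ev_def chi_def smult_sum sum_subtractf smult_diff_right)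
  also have "\<dots> \<in> S"
    using * assms(1) by (intro subsp_sum) (auto simp: subsp_def)
  finally show ?thesis .
qed

lemma ev_eigenvector:
  assumes "lin D" "lin U" "D v = smult a v" "U v = smult b v"
  shows "ev D U p v = smult (chi a b p) v"
  using ev_eigenvector_mod[of "{0}" D U v a b p] assms by (simp add: subsp_def lin_zero)

text \<open>The last letter of a word acts first. Peeling it off reduces the evaluation at
  \<open>x\<close> to those at \<open>D x\<close> and \<open>U x\<close>, a recursion that ends for
  nilpotent operators.\<close>

lemma ev_split_last:
  assumes "p \<in> FA"
  shows "ev D U p x = smult (p []) x + ev D U (\<lambda>w. p (w @ [False])) (D x) + ev D U (\<lambda>w. p (w @ [True])) (U x)"
proof -
  have fin: "finite (supp p)" using assms by (simp add: FA_iff)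
  let ?A = "\<lambda>l. {w. w @ [l] \<in> supp p}"
  have finA: "finite (?A l)" for l
    using finite_vimageI[OF fin, of "\<lambda>w. w @ [l]"] by (simp add: inj_on_def vimage_def)
  have "ev D U p x = (\<Sum>w\<in>{[]} \<union> ((\<lambda>w. w @ [False]) ` ?A False \<union> (\<lambda>w. w @ [True]) ` ?A True).
      smult (p w) (act D U w x))"
  proof (rule ev_superset)
    show "supp p \<subseteq> {[]} \<union> ((\<lambda>w. w @ [False]) ` ?A False \<union> (\<lambda>w. w @ [True]) ` ?A True)"
    proof
      fix w assume "w \<in> supp p"
      then show "w \<in> {[]} \<union> ((\<lambda>w. w @ [False]) ` ?A False \<union> (\<lambda>w. w @ [True]) ` ?A True)"
        by (cases w rule: rev_cases) (auto simp: image_iff, metis (full_types))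
    qed
  qed (simp add: finA)
  also have "\<dots> = smult (p []) x + ((\<Sum>w\<in>?A False. smult (p (w @ [False])) (act D U (w @ [False]) x))
      + (\<Sum>w\<in>?A True. smult (p (w @ [True])) (act D U (w @ [True]) x)))"
    by (subst sum.union_disjoint, simp, simp add: finA, force, subst sum.union_disjoint)
      (auto simp: finA sum.reindex inj_on_def)
  finally show ?thesis by (simp add: ev_def supp_def act_append add.assoc)
qed

lemma chi_zero: "p \<in> FA \<Longrightarrow> chi 0 0 p = p []"
proof -
  assume "p \<in> FA"
  then have fin: "finite (supp p)" by (simp add: FA_iff)
  have "chi 0 0 p = (\<Sum>w\<in>supp p. if w = [] then p [] else 0)"
    unfolding chi_def
  proof (rule sum.cong)
    show "p w * prod_list (map (\<lambda>l. if l then 0 else 0) w) = (if w = [] then p [] else 0)" for w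
      by (cases w) auto
  qed simp
  then show ?thesis using fin by (simp add: supp_def)
qed

section \<open>Modules over down-up algebras and their pullback along an isomorphism\<close>

definition du_rep :: "'a::field \<Rightarrow> 'a \<Rightarrow> 'a op \<Rightarrow> 'a op \<Rightarrow> bool" where
  "du_rep \<alpha> \<gamma> D U \<longleftrightarrow> lin D \<and> lin U
    \<and> (\<forall>x. D (D (U x)) = smult \<alpha> (D (U (D x))) + smult \<gamma> (D x))
    \<and> (\<forall>x. D (U (U x)) = smult \<alpha> (U (D (U x))) + smult \<gamma> (U x))"

lemma du_rep_iff:
  assumes "lin D" "lin U"
  shows "du_rep \<alpha> \<gamma> D U \<longleftrightarrow> (\<forall>r\<in>du_rels \<alpha> 0 \<gamma>. \<forall>x. ev D U r x = 0)"
  using assms unfolding du_rep_def du_rels_def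
  by (simp add: ev_sub ev_add ev_smult ev_mult ev_d ev_u)

lemma ev_du_ideal:
  assumes "du_rep \<alpha> \<gamma> D U" "a \<in> du_ideal \<alpha> 0 \<gamma>"
  shows "ev D U a x = 0"
proof -
  have lin: "lin D" "lin U" using assms(1) by (simp_all add: du_rep_def)
  have sub: "fa_ideal (du_rels \<alpha> 0 \<gamma>) \<subseteq> FA"
    using fa_ideal_set.subset_FA[OF fa_ideal_set_fa_ideal[OF du_rels_FA]] .
  show ?thesis using assms(2) unfolding du_ideal_def
  proof (induction arbitrary: x)
    case (gen s)
    then show ?case using assms(1) du_rep_iff[OF lin] by blast
  next
    case zero
    then show ?case by (simp add: ev_zero)
  next
    case (add a b)
    then show ?case using sub by (subst ev_add) auto
  next
    case (mult a p q)
    then have "a \<in> FA" using sub by blast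
    then show ?case using mult lin lin_zero[OF lin_ev[OF lin]] by (simp add: ev_mult)
  qed
qed

text \<open>\<open>P\<close>, \<open>Q\<close> represent the images of \<open>d\<close>, \<open>u\<close> under an isomorphism
  \<open>A(\<alpha>, 0, \<gamma>) \<rightarrow> A(\<alpha>', 0, \<gamma>')\<close>, and \<open>P'\<close>, \<open>Q'\<close> the images under its inverse:
  all that will be used of the isomorphism is how it pulls representations back.\<close>

definition transfer ::
  "'a::field fa \<Rightarrow> 'a fa \<Rightarrow> 'a fa \<Rightarrow> 'a fa \<Rightarrow> 'a \<Rightarrow> 'a \<Rightarrow> 'a \<Rightarrow> 'a \<Rightarrow> bool" where
  "transfer P Q P' Q' \<alpha> \<gamma> \<alpha>' \<gamma>' \<longleftrightarrow> P \<in> FA \<and> Q \<in> FA \<and>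
    (\<forall>D U. du_rep \<alpha>' \<gamma>' D U \<longrightarrow>
      du_rep \<alpha> \<gamma> (ev D U P) (ev D U Q)
      \<and> ev (ev D U P) (ev D U Q) P' = D \<and> ev (ev D U P) (ev D U Q) Q' = U)"

text \<open>Chosen representatives are multiplicative only modulo the ideal, but the ideal acts as
  zero on a module. Hence acting through representatives of the images of \<open>f\<close> is a
  genuine action, and it is evaluation at the two operators representing the images of
  \<open>d\<close> and \<open>u\<close>.\<close>

lemma transfer_of_homs:
  assumes I: "I = du_ideal \<alpha> 0 \<gamma>" and J: "J = du_ideal \<alpha>' 0 \<gamma>'"
    and f: "qalg_hom f I J" and g: "qalg_hom g J I"
    and fg: "\<And>y. y \<in> qcarrier J \<Longrightarrow> f (g y) = y"
  shows "transfer (qrep (f (qcls I fa_d))) (qrep (f (qcls I fa_u)))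
    (qrep (g (qcls J fa_d))) (qrep (g (qcls J fa_u))) \<alpha> \<gamma> \<alpha>' \<gamma>'"
proof -
  interpret I: fa_ideal_set I unfolding I by (rule fa_ideal_set_du_ideal)
  interpret J: fa_ideal_set J unfolding J by (rule fa_ideal_set_du_ideal)
  define h where "h p = qrep (f (qcls I p))" for p
  have f_mem: "f (qcls I p) \<in> qcarrier J" if "p \<in> FA" for p
    using f that unfolding qalg_hom_def by (auto simp: qcls_mem_qcarrier)
  have h_FA: "h p \<in> FA" if "p \<in> FA" for p
    unfolding h_def using f_mem that J.qrep_FA by blast
  have "du_rep \<alpha> \<gamma> (ev D U (h fa_d)) (ev D U (h fa_u))
      \<and> ev (ev D U (h fa_d)) (ev D U (h fa_u)) (qrep (g (qcls J fa_d))) = D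
      \<and> ev (ev D U (h fa_d)) (ev D U (h fa_u)) (qrep (g (qcls J fa_u))) = U"
    if rep: "du_rep \<alpha>' \<gamma>' D U" for D U
  proof -
    have lin: "lin D" "lin U" using rep by (simp_all add: du_rep_def)
    have ev_qrep: "ev D U (qrep (qcls J r)) x = ev D U r x" if "r \<in> FA" for r x
      using J.qrep_qcls[OF that] ev_du_ideal[OF rep, of "fa_sub r (qrep (qcls J r))" x] that
      by (simp add: J ev_sub)
    have h_one: "ev D U (h fa_one) x = x" for x
      using f unfolding qalg_hom_def h_def by (simp add: ev_qrep ev_one)
    have h_add: "ev D U (h (fa_add p q)) x = ev D U (h p) x + ev D U (h q) x"
      if "p \<in> FA" "q \<in> FA" for p q x
      using f that h_FA[OF that(1)] h_FA[OF that(2)] unfolding qalg_hom_def h_def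
      by (simp add: qcls_mem_qcarrier qadd_def ev_qrep ev_add flip: I.qadd_qcls)
    have h_mult: "ev D U (h (fa_mult p q)) x = ev D U (h p) (ev D U (h q) x)"
      if "p \<in> FA" "q \<in> FA" for p q x
      using f that h_FA[OF that(1)] h_FA[OF that(2)] lin unfolding qalg_hom_def h_def
      by (simp add: qcls_mem_qcarrier qmult_def ev_qrep ev_mult flip: I.qmult_qcls)
    have h_smult: "ev D U (h (fa_smult c p)) x = smult c (ev D U (h p) x)"
      if "p \<in> FA" for c p x
      using f that h_FA[OF that(1)] unfolding qalg_hom_def h_def
      by (simp add: qcls_mem_qcarrier qsmult_def ev_qrep ev_smult flip: I.qsmult_qcls)
    let ?D = "ev D U (h fa_d)" and ?U = "ev D U (h fa_u)"
    have linD: "lin ?D" "lin ?U" using lin_ev[OF lin] by auto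
    have h_ev: "ev D U (h p) x = ev ?D ?U p x" if "p \<in> FA" for p x
      using that
    proof (induction p arbitrary: x rule: FA_induct)
      case one
      then show ?case by (simp add: h_one ev_one)
    next
      case (d p)
      then show ?case using linD by (simp add: h_mult ev_mult ev_d)
    next
      case (u p)
      then show ?case using linD by (simp add: h_mult ev_mult ev_u)
    next
      case (smult c p)
      then show ?case by (simp add: h_smult ev_smult)
    next
      case (add p q)
      then show ?case by (simp add: h_add ev_add)
    qed
    have "ev ?D ?U r x = 0" if "r \<in> du_rels \<alpha> 0 \<gamma>" for r x
    proof -
      have r: "r \<in> FA" "r \<in> I" using that du_rels_FA by (auto simp: I du_ideal_def intro: fa_ideal.gen)
      \<comment> \<open>Zero is written as a multiple of the unit so that \<open>h_smult\<close>
        applies to it.\<close>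
      have "fa_sub r (fa_smult 0 fa_one) = r" by (simp add: fa_sub_def fa_smult_def)
      then have "qcls I r = qcls I (fa_smult 0 fa_one)"
        using r by (simp add: I.qcls_eq_iff)
      then have "ev D U (h r) x = ev D U (h (fa_smult 0 fa_one)) x" by (simp add: h_def)
      then show ?thesis using h_ev[OF r(1)] h_smult[OF fa_one_FA, of 0] by simp
    qed
    then have "du_rep \<alpha> \<gamma> ?D ?U" using du_rep_iff[OF linD] by blast
    moreover have "ev ?D ?U (qrep (g (qcls J r))) x = ev D U r x" if "r \<in> FA" for r x
    proof -
      have gm: "g (qcls J r) \<in> qcarrier I"
        using g that unfolding qalg_hom_def by (auto simp: qcls_mem_qcarrier)
      \<comment> \<open>Because \<open>f\<close> undoes \<open>g\<close>, evaluating the inverse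
        images recovers the original operators.\<close>
      have "h (qrep (g (qcls J r))) = qrep (qcls J r)"
        unfolding h_def I.qcls_qrep[OF gm] using fg that by (simp add: qcls_mem_qcarrier)
      then show ?thesis using h_ev[OF I.qrep_FA[OF gm]] ev_qrep[OF that] by metis
    qed
    then have "ev ?D ?U (qrep (g (qcls J fa_d))) = D" "ev ?D ?U (qrep (g (qcls J fa_u))) = U"
      by (simp_all add: fun_eq_iff ev_d ev_u)
    ultimately show ?thesis by blast
  qed
  then show ?thesis using h_FA[OF fa_d_FA] h_FA[OF fa_u_FA] unfolding transfer_def h_def by blast
qed

lemma down_up_iso_imp_transfer:
  assumes "down_up_iso \<alpha> 0 \<gamma> \<alpha>' 0 \<gamma>'"
  obtains P Q P' Q' where "transfer P Q P' Q' \<alpha> \<gamma> \<alpha>' \<gamma>'" "transfer P' Q' P Q \<alpha>' \<gamma>' \<alpha> \<gamma>"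
proof -
  obtain f g where "qalg_hom f (du_ideal \<alpha> 0 \<gamma>) (du_ideal \<alpha>' 0 \<gamma>')"
    "qalg_hom g (du_ideal \<alpha>' 0 \<gamma>') (du_ideal \<alpha> 0 \<gamma>)"
    "\<And>x. x \<in> qcarrier (du_ideal \<alpha> 0 \<gamma>) \<Longrightarrow> g (f x) = x"
    "\<And>y. y \<in> qcarrier (du_ideal \<alpha>' 0 \<gamma>') \<Longrightarrow> f (g y) = y"
    using qalg_iso_imp_inverse_homs[OF assms[unfolded down_up_iso_def] fa_ideal_set_du_ideal fa_ideal_set_du_ideal]
    by metis
  then show ?thesis using that transfer_of_homs[OF refl refl] by metis
qed

section \<open>One-dimensional representations and their tangent spaces\<close>

definition du_pt :: "'a::field \<Rightarrow> 'a \<Rightarrow> 'a \<Rightarrow> 'a \<Rightarrow> bool" where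
  "du_pt \<alpha> \<gamma> a b \<longleftrightarrow> a * a * b * (1 - \<alpha>) = \<gamma> * a \<and> a * b * b * (1 - \<alpha>) = \<gamma> * b"

lemma lin_smult_op: "lin (smult a)"
  by (simp add: lin_def smult_add_right mult.commute)

lemma du_rep_smult_iff: "du_rep \<alpha> \<gamma> (smult a) (smult b) \<longleftrightarrow> du_pt \<alpha> \<gamma> a b"
proof
  assume "du_rep \<alpha> \<gamma> (smult a) (smult b)"
  then have "smult a (smult a (smult b [:1:])) = smult \<alpha> (smult a (smult b (smult a [:1:]))) + smult \<gamma> (smult a [:1:])"
    and "smult a (smult b (smult b [:1:])) = smult \<alpha> (smult b (smult a (smult b [:1:]))) + smult \<gamma> (smult b [:1:])"
    unfolding du_rep_def by blast+
  then have "a * (a * b) = \<alpha> * (a * (b * a)) + \<gamma> * a" "a * (b * b) = \<alpha> * (b * (a * b)) + \<gamma> * b"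
    by simp_all
  then show "du_pt \<alpha> \<gamma> a b" by (simp add: du_pt_def algebra_simps)
next
  assume "du_pt \<alpha> \<gamma> a b"
  then have "a * (a * b) = \<alpha> * (a * (b * a)) + \<gamma> * a" "a * (b * b) = \<alpha> * (b * (a * b)) + \<gamma> * b"
    by (simp_all add: du_pt_def algebra_simps)
  then show "du_rep \<alpha> \<gamma> (smult a) (smult b)"
    unfolding du_rep_def by (auto simp: lin_smult_op simp flip: smult_add_left)
qed

lemma ev_smult_op: "ev (smult a) (smult b) p = smult (chi a b p)"
  using ev_eigenvector[OF lin_smult_op lin_smult_op] by blast

lemma smult_op_eq_iff: "smult a = smult b \<longleftrightarrow> a = b" for a :: "'a::field"
proof
  assume "smult a = smult b"
  then have "smult a 1 = smult b 1" by metis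
  then show "a = b" by simp
qed simp

text \<open>On one-dimensional modules the pullback is the map of points with coordinates
  \<open>P\<close>, \<open>Q\<close>, and \<open>P'\<close>, \<open>Q'\<close> invert it.\<close>

lemma transfer_pt:
  assumes "transfer P Q P' Q' \<alpha> \<gamma> \<alpha>' \<gamma>'" "du_pt \<alpha>' \<gamma>' a b"
  shows "du_pt \<alpha> \<gamma> (chi a b P) (chi a b Q)"
    "chi (chi a b P) (chi a b Q) P' = a" "chi (chi a b P) (chi a b Q) Q' = b"
  using assms unfolding transfer_def
  by (metis du_rep_smult_iff ev_smult_op smult_op_eq_iff)+

text \<open>On the span of \<open>1\<close> and \<open>e\<close> the operators are upper triangular \<open>2 \<times> 2\<close> matrices; the equations
  are the off-diagonal entries of the two relations.\<close>

lemma du_rep_triangular: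
  assumes rep: "du_rep \<alpha> \<gamma> D U" and e: "coeff e 0 = 0"
    and "D 1 = [:a:]" "U 1 = [:b:]" "D e = smult a' e + [:X:]" "U e = smult b' e + [:Y:]"
  shows "Y * (a * a - \<alpha> * a * a') + X * (a * b' + a' * b' - \<alpha> * a * b - \<alpha> * a' * b' - \<gamma>) = 0"
    and "Y * (a * b + a * b' - \<alpha> * a * b - \<alpha> * a' * b' - \<gamma>) + X * (b' * b' - \<alpha> * b * b') = 0"
proof -
  have lin: "lin D" "lin U" using rep by (simp_all add: du_rep_def)
  have const: "D [:c:] = [:c * a:]" "U [:c:] = [:c * b:]" for c
    using lin_smult[OF lin(1), of c 1] lin_smult[OF lin(2), of c 1] assms(3,4) by simp_all
  note simps = assms(3-6) lin[THEN lin_add] lin[THEN lin_smult] const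
  \<comment> \<open>As \<open>e\<close> has no constant term, the constant coefficient isolates the
    off-diagonal entry.\<close>
  have "coeff (D (D (U e))) 0 = coeff (smult \<alpha> (D (U (D e))) + smult \<gamma> (D e)) 0"
    and "coeff (D (U (U e))) 0 = coeff (smult \<alpha> (U (D (U e))) + smult \<gamma> (U e)) 0"
    using rep by (simp_all add: du_rep_def)
  then have "b' * (a' * X) + (b' * X * a + Y * a * a) = \<alpha> * (a' * (b' * X) + (a' * Y * a + X * b * a)) + \<gamma> * X"
    and "b' * (b' * X) + (b' * Y * a + Y * b * a) = \<alpha> * (b' * (a' * Y) + (b' * X * b + Y * a * b)) + \<gamma> * Y"
    using e by (simp_all add: simps algebra_simps)
  then show "Y * (a * a - \<alpha> * a * a') + X * (a * b' + a' * b' - \<alpha> * a * b - \<alpha> * a' * b' - \<gamma>) = 0"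
    and "Y * (a * b + a * b' - \<alpha> * a * b - \<alpha> * a' * b' - \<gamma>) + X * (b' * b' - \<alpha> * b * b') = 0"
    by (simp_all add: algebra_simps)
qed

lemma subsp_const: "subsp (range (\<lambda>c. [:c:]))"
  unfolding subsp_def by (auto simp: image_iff)

text \<open>The constants are a submodule, so the pullback is triangular again: its diagonal is
  given by characters, and only the extension class is unknown.\<close>

lemma transfer_triangular:
  assumes tr: "transfer P Q P' Q' \<alpha> \<gamma> \<alpha>' \<gamma>'" and rep: "du_rep \<alpha>' \<gamma>' D U"
    and one: "D 1 = [:a:]" "U 1 = [:b:]" and e: "D e = smult a' e + [:X:]" "U e = smult b' e + [:Y:]"
  obtains X' Y' where "ev D U P 1 = [:chi a b P:]" "ev D U Q 1 = [:chi a b Q:]"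
    "ev D U P e = smult (chi a' b' P) e + [:X':]" "ev D U Q e = smult (chi a' b' Q) e + [:Y':]"
proof -
  have lin: "lin D" "lin U" using rep by (simp_all add: du_rep_def)
  have const: "D [:c:] = [:c * a:]" "U [:c:] = [:c * b:]" for c
    using lin_smult[OF lin(1), of c 1] lin_smult[OF lin(2), of c 1] one by simp_all
  have "ev D U p 1 = [:chi a b p:]" for p
    using ev_eigenvector[OF lin, of 1 a b p] one by simp
  moreover have "ev D U p e - smult (chi a' b' p) e \<in> range (\<lambda>c. [:c:])" for p
    by (rule ev_eigenvector_mod[OF subsp_const lin]) (auto simp: const e)
  ultimately show ?thesis using that by (metis (no_types, lifting) add.commute diff_add_cancel imageE)
qed

text \<open>The universal first order deformation \<open>d = a + \<epsilon>\<^sub>1\<close>, \<open>u = b + \<epsilon>\<^sub>2\<close>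
  of a one-dimensional representation with two-dimensional tangent space.\<close>

definition tangent_d :: "'a::field \<Rightarrow> 'a op" where
  "tangent_d a x = smult a x + [:coeff x 1:]"
definition tangent_u :: "'a::field \<Rightarrow> 'a op" where
  "tangent_u b x = smult b x + [:coeff x 2:]"

text \<open>For \<alpha> = 1 and \<gamma> = 0 commuting operators satisfy the relations; at the
  origin the mixed products of the two operators vanish.\<close>

lemma du_rep_tangent:
  assumes "\<gamma> = 0" "\<alpha> = 1 \<or> a = 0 \<and> b = 0"
  shows "du_rep \<alpha> \<gamma> (tangent_d a) (tangent_u b)"
proof -
  have "lin (tangent_d a)" "lin (tangent_u b)"
    by (simp_all add: lin_def tangent_d_def tangent_u_def smult_add_right mult.commute)
  moreover have "tangent_d a (tangent_u b x) = tangent_u b (tangent_d a x)" for x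
    by (simp add: tangent_d_def tangent_u_def numeral_2_eq_2 smult_add_right mult.commute)
  moreover have "tangent_d 0 (tangent_u 0 x) = 0" "tangent_u 0 (tangent_d 0 x) = 0" for x :: "'a poly"
    by (simp_all add: tangent_d_def tangent_u_def numeral_2_eq_2)
  ultimately show ?thesis using assms unfolding du_rep_def by (auto simp: lin_zero)
qed

text \<open>The differential of the point map is injective. A tangent direction in its kernel would
  give a vector on which the pulled back operators are scalars; by the inverse so would be the
  original ones, which is false for every nonzero direction.\<close>

lemma transfer_tangent:
  assumes tr: "transfer P Q P' Q' \<alpha> \<gamma> \<alpha>' \<gamma>'" and "\<gamma>' = 0" "\<alpha>' = 1 \<or> a = 0 \<and> b = 0"
    and P: "ev (tangent_d a) (tangent_u b) P [:0, 1:] = [:X1, chi a b P:]"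
      "ev (tangent_d a) (tangent_u b) P [:0, 0, 1:] = [:X2, 0, chi a b P:]"
    and Q: "ev (tangent_d a) (tangent_u b) Q [:0, 1:] = [:Y1, chi a b Q:]"
      "ev (tangent_d a) (tangent_u b) Q [:0, 0, 1:] = [:Y2, 0, chi a b Q:]"
  shows "X1 * Y2 \<noteq> X2 * Y1"
proof
  assume det: "X1 * Y2 = X2 * Y1"
  let ?D = "tangent_d a" and ?U = "tangent_u b"
  have rep: "du_rep \<alpha>' \<gamma>' ?D ?U" by (rule du_rep_tangent) (use assms in auto)
  let ?D' = "ev ?D ?U P" and ?U' = "ev ?D ?U Q"
  have rep': "du_rep \<alpha> \<gamma> ?D' ?U'" and inv: "ev ?D' ?U' P' = ?D" "ev ?D' ?U' Q' = ?U"
    using tr rep by (simp_all add: transfer_def)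
  have lin: "lin ?D'" "lin ?U'" using rep' by (simp_all add: du_rep_def)
  \<comment> \<open>A kernel vector of the singular matrix with columns \<open>(X1, Y1)\<close> and
    \<open>(X2, Y2)\<close>.\<close>
  obtain k l where kl: "k \<noteq> 0 \<or> l \<noteq> 0" "k * X1 + l * X2 = 0" "k * Y1 + l * Y2 = 0"
  proof (cases "X1 = 0 \<and> X2 = 0")
    case True
    show ?thesis
    proof (cases "Y1 = 0 \<and> Y2 = 0")
      case True
      then show ?thesis using \<open>X1 = 0 \<and> X2 = 0\<close> that[of 1 0] by simp
    next
      case False
      then show ?thesis using \<open>X1 = 0 \<and> X2 = 0\<close> that[of Y2 "- Y1"] by auto
    qed
  next
    case False
    then show ?thesis using det that[of X2 "- X1"] by (auto simp: algebra_simps)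
  qed
  define v where "v = [:0, k, l:]"
  have v: "v = smult k [:0, 1:] + smult l [:0, 0, 1:]" by (simp add: v_def)
  have "?D' v = smult (chi a b P) v" "?U' v = smult (chi a b Q) v"
    unfolding v lin[THEN lin_add] lin[THEN lin_smult] P Q
    using kl(2,3) by (simp_all add: mult.commute)
  then have "\<exists>c. ?D v = smult c v" "\<exists>c. ?U v = smult c v"
    using ev_eigenvector[OF lin] inv by metis+
  then show False using kl(1) by (auto simp: v_def tangent_d_def tangent_u_def numeral_2_eq_2)
qed

text \<open>Two independent tangent vectors solve the linearized relations at the image point, so
  all coefficients of these linear equations vanish.\<close>

lemma transfer_full_tangent:
  assumes tr: "transfer P Q P' Q' \<alpha> \<gamma> \<alpha>' \<gamma>'" and "\<gamma>' = 0" "\<alpha>' = 1 \<or> a = 0 \<and> b = 0"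
  shows "chi a b P * chi a b P * (1 - \<alpha>) = 0" "chi a b Q * chi a b Q * (1 - \<alpha>) = 0"
    "2 * chi a b P * chi a b Q * (1 - \<alpha>) = \<gamma>"
proof -
  let ?D = "tangent_d a" and ?U = "tangent_u b"
  have rep: "du_rep \<alpha>' \<gamma>' ?D ?U" by (rule du_rep_tangent) (use assms in auto)
  let ?D' = "ev ?D ?U P" and ?U' = "ev ?D ?U Q" and ?a = "chi a b P" and ?b = "chi a b Q"
  have rep': "du_rep \<alpha> \<gamma> ?D' ?U'" using tr rep by (simp_all add: transfer_def)
  have one: "?D 1 = [:a:]" "?U 1 = [:b:]" by (simp_all add: tangent_d_def tangent_u_def)
  have e1: "?D [:0, 1:] = smult a [:0, 1:] + [:1:]" "?U [:0, 1:] = smult b [:0, 1:] + [:0:]"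
    and e2: "?D [:0, 0, 1:] = smult a [:0, 0, 1:] + [:0:]" "?U [:0, 0, 1:] = smult b [:0, 0, 1:] + [:1:]"
    by (simp_all add: tangent_d_def tangent_u_def numeral_2_eq_2)
  obtain X1 Y1 where 1: "?D' 1 = [:?a:]" "?U' 1 = [:?b:]"
    "?D' [:0, 1:] = smult ?a [:0, 1:] + [:X1:]" "?U' [:0, 1:] = smult ?b [:0, 1:] + [:Y1:]"
    by (rule transfer_triangular[OF tr rep one e1])
  obtain X2 Y2 where 2:
    "?D' [:0, 0, 1:] = smult ?a [:0, 0, 1:] + [:X2:]" "?U' [:0, 0, 1:] = smult ?b [:0, 0, 1:] + [:Y2:]"
    by (rule transfer_triangular[OF tr rep one e2])
  have det: "X1 * Y2 \<noteq> X2 * Y1"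
    by (rule transfer_tangent[OF assms]) (use 1 2 in simp_all)
  let ?A = "?a * ?a - \<alpha> * ?a * ?a" and ?C = "?b * ?b - \<alpha> * ?b * ?b"
  let ?B = "?a * ?b + ?a * ?b - \<alpha> * ?a * ?b - \<alpha> * ?a * ?b - \<gamma>"
  have eqs: "Y1 * ?A + X1 * ?B = 0" "Y1 * ?B + X1 * ?C = 0" "Y2 * ?A + X2 * ?B = 0" "Y2 * ?B + X2 * ?C = 0"
    using du_rep_triangular[OF rep' _ 1] du_rep_triangular[OF rep' _ 1(1,2) 2] by simp_all
  have lin_indep: "z = 0 \<and> w = 0" if "Y1 * z + X1 * w = 0" "Y2 * z + X2 * w = 0" for z w
  proof -
    have "(X1 * Y2 - X2 * Y1) * z = X1 * (Y2 * z + X2 * w) - X2 * (Y1 * z + X1 * w)"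
      "(X1 * Y2 - X2 * Y1) * w = Y2 * (Y1 * z + X1 * w) - Y1 * (Y2 * z + X2 * w)"
      by (simp_all add: algebra_simps)
    then show ?thesis using that det by auto
  qed
  have "?A = 0" "?B = 0" "?C = 0"
    using lin_indep[OF eqs(1,3)] lin_indep[OF eqs(2,4)] by blast+
  then show "?a * ?a * (1 - \<alpha>) = 0" "?b * ?b * (1 - \<alpha>) = 0" "2 * ?a * ?b * (1 - \<alpha>) = \<gamma>"
    by (simp_all add: algebra_simps)
qed

text \<open>The origin has a two-dimensional tangent space. At its image the first equation forces
  \<open>a = 0\<close> or \<alpha> = 1, and either makes the third one read \<gamma> = 0.\<close>

lemma transfer_gamma_zero:
  assumes "transfer P Q P' Q' \<alpha> \<gamma> \<alpha>' 0"
  shows "\<gamma> = 0"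
proof -
  have "chi 0 0 P * chi 0 0 P * (1 - \<alpha>) = 0" "2 * chi 0 0 P * chi 0 0 Q * (1 - \<alpha>) = \<gamma>"
    using transfer_full_tangent[OF assms, of 0 0] by simp_all
  then show ?thesis by auto
qed

text \<open>If \<gamma>' = 0, every point of the plane has full tangent space and would go to the
  origin, against injectivity. If \<gamma>' is nonzero, the origin is the only point on the side of
  parameter 1, while the other side has at least two.\<close>

lemma transfer_alpha_one:
  assumes tr: "transfer P Q P' Q' \<alpha> \<gamma> 1 \<gamma>'" and tr': "transfer P' Q' P Q 1 \<gamma>' \<alpha> \<gamma>"
  shows "\<alpha> = 1"
proof (rule ccontr)
  assume \<alpha>: "\<alpha> \<noteq> 1"
  show False
  proof (cases "\<gamma>' = 0")
    case True
    have "chi a b P = 0 \<and> chi a b Q = 0" for a b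
      using transfer_full_tangent(1,2)[OF tr, of a b] \<alpha> True by simp
    moreover have "du_pt 1 \<gamma>' a b" for a b using True by (simp add: du_pt_def)
    ultimately have "chi 0 0 P' = a" for a using transfer_pt(2)[OF tr] by metis
    then show False using zero_neq_one by metis
  next
    case False
    have "du_pt \<alpha> \<gamma> 0 0" "du_pt \<alpha> \<gamma> 1 (\<gamma> / (1 - \<alpha>))" using \<alpha> by (simp_all add: du_pt_def)
    moreover have "chi a b P' = 0 \<and> chi a b Q' = 0" if "du_pt \<alpha> \<gamma> a b" for a b
      using transfer_pt(1)[OF tr' that] False by (simp add: du_pt_def)
    ultimately have "chi 0 0 P = 0" "chi 0 0 P = 1" using transfer_pt(2)[OF tr'] by metis+
    then show False by simp
  qed
qed

section \<open>The case \<open>\<gamma> = 0\<close>\<close>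

text \<open>A weighted lowering operator. A product of three of these has a single entry, from the
  cube of the variable to the constants, so a cubic relation becomes one multilinear equation in the
  weights.\<close>

definition nil_op :: "'a::field \<Rightarrow> 'a \<Rightarrow> 'a \<Rightarrow> 'a op" where
  "nil_op c1 c2 c3 x = [:c1 * coeff x 1, c2 * coeff x 2, c3 * coeff x 3:]"

lemma lin_nil_op: "lin (nil_op c1 c2 c3)"
  by (simp add: lin_def nil_op_def algebra_simps)

lemma nil_op_basis:
  "nil_op c1 c2 c3 [:1:] = 0"
  "nil_op c1 c2 c3 [:0, 1:] = smult c1 [:1:]"
  "nil_op c1 c2 c3 [:0, 0, 1:] = smult c2 [:0, 1:]"
  "nil_op c1 c2 c3 [:0, 0, 0, 1:] = smult c3 [:0, 0, 1:]"
  by (simp_all add: nil_op_def numeral_2_eq_2 numeral_3_eq_3)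

lemma du_rep_nil_op:
  assumes "d1 * (d2 * u3 - \<alpha> * u2 * d3) = 0" "(d1 * u2 - \<alpha> * u1 * d2) * u3 = 0"
  shows "du_rep \<alpha> 0 (nil_op d1 d2 d3) (nil_op u1 u2 u3)"
proof -
  have "d1 * (d2 * (u3 * c)) = \<alpha> * (d1 * (u2 * (d3 * c)))" "d1 * (u2 * (u3 * c)) = \<alpha> * (u1 * (d2 * (u3 * c)))" for c
  proof -
    have "d1 * (d2 * (u3 * c)) - \<alpha> * (d1 * (u2 * (d3 * c))) = d1 * (d2 * u3 - \<alpha> * u2 * d3) * c"
      "d1 * (u2 * (u3 * c)) - \<alpha> * (u1 * (d2 * (u3 * c))) = (d1 * u2 - \<alpha> * u1 * d2) * u3 * c"
      by (simp_all add: algebra_simps)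
    then show "d1 * (d2 * (u3 * c)) = \<alpha> * (d1 * (u2 * (d3 * c)))"
      "d1 * (u2 * (u3 * c)) = \<alpha> * (u1 * (d2 * (u3 * c)))"
      using assms by simp_all
  qed
  then show ?thesis
    unfolding du_rep_def by (simp add: lin_nil_op) (simp add: nil_op_def numeral_2_eq_2 numeral_3_eq_3)
qed

lemma FA_append: "p \<in> FA \<Longrightarrow> (\<lambda>w. p (w @ [l])) \<in> FA"
  using finite_vimageI[of "supp p" "\<lambda>w. w @ [l]"]
  by (simp add: FA_iff inj_on_def vimage_def supp_def)

text \<open>Words of length at least two lower the degree by at least two, so the diagonal sees only
  the constant term of \<open>p\<close> and the first superdiagonal only its linear part.\<close>

lemma ev_nil_op:
  fixes d1 d2 d3 u1 u2 u3 :: "'a::field"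
  defines "D \<equiv> nil_op d1 d2 d3" and "U \<equiv> nil_op u1 u2 u3"
  assumes "p \<in> FA"
  shows "ev D U p [:1:] = [:p []:]"
    "ev D U p [:0, 1:] = [:p [False] * d1 + p [True] * u1, p []:]"
    "\<exists>c. ev D U p [:0, 0, 1:] = [:c, p [False] * d2 + p [True] * u2, p []:]"
    "\<exists>c c'. ev D U p [:0, 0, 0, 1:] = [:c, c', p [False] * d3 + p [True] * u3, p []:]"
proof -
  have lin: "lin (ev D U q)" for q unfolding D_def U_def by (intro lin_ev lin_nil_op)
  have basis:
    "D [:1:] = 0" "U [:1:] = 0"
    "D [:0, 1:] = smult d1 [:1:]" "U [:0, 1:] = smult u1 [:1:]"
    "D [:0, 0, 1:] = smult d2 [:0, 1:]" "U [:0, 0, 1:] = smult u2 [:0, 1:]"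
    "D [:0, 0, 0, 1:] = smult d3 [:0, 0, 1:]" "U [:0, 0, 0, 1:] = smult u3 [:0, 0, 1:]"
    unfolding D_def U_def by (simp_all only: nil_op_basis)
  have e0: "ev D U q [:1:] = [:q []:]" if "q \<in> FA" for q
    unfolding ev_split_last[OF that, of D U "[:1:]"] basis by (simp add: lin[THEN lin_zero])
  have e1: "ev D U q [:0, 1:] = [:q [False] * d1 + q [True] * u1, q []:]" if "q \<in> FA" for q
    unfolding ev_split_last[OF that, of D U "[:0, 1:]"] basis lin[THEN lin_smult]
      e0[OF FA_append[OF that]] by (simp add: mult.commute)
  have e2: "\<exists>c. ev D U q [:0, 0, 1:] = [:c, q [False] * d2 + q [True] * u2, q []:]" if "q \<in> FA" for q
    unfolding ev_split_last[OF that, of D U "[:0, 0, 1:]"] basis lin[THEN lin_smult]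
      e1[OF FA_append[OF that]] by (simp add: mult.commute)
  have e3: "\<exists>c c'. ev D U q [:0, 0, 0, 1:] = [:c, c', q [False] * d3 + q [True] * u3, q []:]"
    if q: "q \<in> FA" for q
  proof -
    obtain c1 c2 where 1: "ev D U (\<lambda>w. q (w @ [False])) [:0, 0, 1:] = [:c1, c2, q [False]:]"
      using e2[OF FA_append[OF q, of False]] by (metis append_Nil)
    obtain c3 c4 where 2: "ev D U (\<lambda>w. q (w @ [True])) [:0, 0, 1:] = [:c3, c4, q [True]:]"
      using e2[OF FA_append[OF q, of True]] by (metis append_Nil)
    show ?thesis
      unfolding ev_split_last[OF q, of D U "[:0, 0, 0, 1:]"] basis lin[THEN lin_smult] 1 2
      by (simp add: mult.commute)
  qed
  show "ev D U p [:1:] = [:p []:]"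
    "ev D U p [:0, 1:] = [:p [False] * d1 + p [True] * u1, p []:]"
    "\<exists>c. ev D U p [:0, 0, 1:] = [:c, p [False] * d2 + p [True] * u2, p []:]"
    "\<exists>c c'. ev D U p [:0, 0, 0, 1:] = [:c, c', p [False] * d3 + p [True] * u3, p []:]"
    using e0 e1 e2 e3 assms(3) by blast+
qed

text \<open>The degree three relations of \<open>A(\<alpha>', 0, 0)\<close>, as multilinear equations in three vectors
  \<open>(d\<^sub>i, u\<^sub>i)\<close>, are mapped to those of \<open>A(\<alpha>, 0, 0)\<close> by the linear part of \<open>(P, Q)\<close>.\<close>

lemma transfer_nil:
  assumes tr: "transfer P Q P' Q' \<alpha> 0 \<alpha>' 0" and zero: "P [] = 0" "Q [] = 0"
    and "d1 * (d2 * u3 - \<alpha>' * u2 * d3) = 0" "(d1 * u2 - \<alpha>' * u1 * d2) * u3 = 0"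
    and p: "p = (\<lambda>d u. P [False] * d + P [True] * u)" and q: "q = (\<lambda>d u. Q [False] * d + Q [True] * u)"
  shows "p d1 u1 * (p d2 u2 * q d3 u3 - \<alpha> * q d2 u2 * p d3 u3) = 0"
    "(p d1 u1 * q d2 u2 - \<alpha> * q d1 u1 * p d2 u2) * q d3 u3 = 0"
proof -
  let ?D = "nil_op d1 d2 d3" and ?U = "nil_op u1 u2 u3"
  define D where "D = ev ?D ?U P"
  define U where "U = ev ?D ?U Q"
  have FA: "P \<in> FA" "Q \<in> FA" using tr by (simp_all add: transfer_def)
  have rep: "du_rep \<alpha> 0 D U"
    using tr du_rep_nil_op[OF assms(4,5)] unfolding transfer_def D_def U_def by blast
  have lin: "lin D" "lin U" using rep by (simp_all add: du_rep_def)
  obtain c where D2: "D [:0, 0, 1:] = [:c, p d2 u2:]"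
    using ev_nil_op(3)[OF FA(1), of d1 d2 d3 u1 u2 u3] zero unfolding p D_def by auto
  obtain c' where U2: "U [:0, 0, 1:] = [:c', q d2 u2:]"
    using ev_nil_op(3)[OF FA(2), of d1 d2 d3 u1 u2 u3] zero unfolding q U_def by auto
  obtain k k' where D3: "D [:0, 0, 0, 1:] = [:k, k', p d3 u3:]"
    using ev_nil_op(4)[OF FA(1), of d1 d2 d3 u1 u2 u3] zero unfolding p D_def by auto
  obtain l l' where U3: "U [:0, 0, 0, 1:] = [:l, l', q d3 u3:]"
    using ev_nil_op(4)[OF FA(2), of d1 d2 d3 u1 u2 u3] zero unfolding q U_def by auto
  have 1: "D [:0, 1:] = [:p d1 u1:]" "U [:0, 1:] = [:q d1 u1:]" "D [:1:] = 0" "U [:1:] = 0"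
    using ev_nil_op(1,2)[OF FA(1), of d1 d2 d3 u1 u2 u3] ev_nil_op(1,2)[OF FA(2), of d1 d2 d3 u1 u2 u3]
      zero by (simp_all add: D_def U_def p q)
  have expand: "[:x, y, z:] = smult x [:1:] + smult y [:0, 1:] + smult z [:0, 0, 1:]" for x y z :: 'a
    by simp
  have D: "D [:x, y, z:] = [:y * p d1 u1 + z * c, z * p d2 u2:]" for x y z
    unfolding expand[of x y z] lin[THEN lin_add] lin[THEN lin_smult] 1 D2 by simp
  have U: "U [:x, y, z:] = [:y * q d1 u1 + z * c', z * q d2 u2:]" for x y z
    unfolding expand[of x y z] lin[THEN lin_add] lin[THEN lin_smult] 1 U2 by simp
  have D': "D [:x, y:] = [:y * p d1 u1:]" and U': "U [:x, y:] = [:y * q d1 u1:]" for x y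
    using D[of x y 0] U[of x y 0] by simp_all
  have "D (D (U [:0, 0, 0, 1:])) = smult \<alpha> (D (U (D [:0, 0, 0, 1:])))"
    "D (U (U [:0, 0, 0, 1:])) = smult \<alpha> (U (D (U [:0, 0, 0, 1:])))"
    using rep by (simp_all add: du_rep_def)
  then show "p d1 u1 * (p d2 u2 * q d3 u3 - \<alpha> * q d2 u2 * p d3 u3) = 0"
    "(p d1 u1 * q d2 u2 - \<alpha> * q d1 u1 * p d2 u2) * q d3 u3 = 0"
    unfolding D3 U3 D U D' U' by (simp_all add: algebra_simps)
qed

lemma transfer_graded:
  assumes tr: "transfer P Q P' Q' \<alpha> 0 \<alpha>' 0" and \<alpha>: "\<alpha> \<noteq> 1"
  shows "\<alpha>' = \<alpha>"
proof -
  have FA: "P \<in> FA" "Q \<in> FA" using tr by (simp_all add: transfer_def)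
  \<comment> \<open>A point with full tangent space must go to the origin when \<alpha> differs from
    1.\<close>
  have zero: "P [] = 0" "Q [] = 0"
    using transfer_full_tangent(1,2)[OF tr, of 0 0] \<alpha> by (simp_all add: chi_zero FA)
  define p where "p = (\<lambda>d u. P [False] * d + P [True] * u)"
  define q where "q = (\<lambda>d u. Q [False] * d + Q [True] * u)"
  note nil = transfer_nil[OF tr zero _ _ p_def q_def]
  \<comment> \<open>At the origin the tangent operators read off the coefficients of
    \<open>d\<close> and \<open>u\<close>, so the linear part is invertible.\<close>
  have eps: "ev (tangent_d 0) (tangent_u 0) r [:0, 1:] = [:r [False], r []:]"
    "ev (tangent_d 0) (tangent_u 0) r [:0, 0, 1:] = [:r [True], 0, r []:]" if "r \<in> FA" for r :: "'a fa"
  proof -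
    have lin: "lin (tangent_d (0::'a))" "lin (tangent_u (0::'a))"
      using du_rep_tangent[of "0::'a" 1 0 0] by (simp_all add: du_rep_def)
    have one: "ev (tangent_d 0) (tangent_u 0) r 1 = [:r []:]" if "r \<in> FA" for r :: "'a fa"
      using ev_eigenvector[OF lin, of 1 0 0 r] that by (simp add: chi_zero tangent_d_def tangent_u_def)
    show "ev (tangent_d 0) (tangent_u 0) r [:0, 1:] = [:r [False], r []:]"
      unfolding ev_split_last[OF that, of _ _ "[:0, 1:]"]
      using one[OF FA_append[OF that]] lin_zero[OF lin_ev[OF lin]]
      by (simp add: tangent_d_def tangent_u_def numeral_2_eq_2 one_pCons)
    show "ev (tangent_d 0) (tangent_u 0) r [:0, 0, 1:] = [:r [True], 0, r []:]"
      unfolding ev_split_last[OF that, of _ _ "[:0, 0, 1:]"]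
      using one[OF FA_append[OF that]] lin_zero[OF lin_ev[OF lin]]
      by (simp add: tangent_d_def tangent_u_def numeral_2_eq_2 one_pCons)
  qed
  have det: "P [False] * Q [True] \<noteq> P [True] * Q [False]"
    by (rule transfer_tangent[OF tr, of 0 0]) (use eps FA zero in \<open>simp_all add: chi_zero\<close>)
  \<comment> \<open>The words \<open>d d d\<close> and, next, \<open>u u u\<close> occur in no
    relation, so the corresponding triples of equal vectors are solutions.\<close>
  have "P [False] = 0 \<or> Q [False] = 0"
    using nil(1)[of 1 1 0 0 1 0] \<alpha> by (auto simp: p_def q_def algebra_simps)
  moreover have "P [True] = 0 \<or> Q [True] = 0"
    using nil(1)[of 0 0 1 1 0 1] \<alpha> by (auto simp: p_def q_def algebra_simps)
  \<comment> \<open>The antidiagonal case: the triple of \<open>u u d\<close> is a solution, but its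
    image is a triple of \<open>d d u\<close>, which violates the first relation.\<close>
  moreover have "\<not> (P [False] = 0 \<and> Q [True] = 0)"
    using nil(1)[of 0 0 0 1 1 1] det by (auto simp: p_def q_def)
  ultimately have "P [True] = 0" "Q [False] = 0" "P [False] \<noteq> 0" "Q [True] \<noteq> 0"
    using det by auto
  \<comment> \<open>The diagonal case: the triple of vectors \<open>(1, 1/\<alpha>')\<close>,
    \<open>(1, 1)\<close>, \<open>(1, \<alpha>')\<close> is a solution. For \<alpha>' = 0 the
    default \<open>inverse 0 = 0\<close> does no harm, since then \<open>u3 = 0\<close>.\<close>
  then show ?thesis
    using nil(1)[of 1 1 \<alpha>' 1 1 "inverse \<alpha>'"]
    by (cases "\<alpha>' = 0") (auto simp: p_def q_def algebra_simps)
qed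

section \<open>The case of nonzero \<open>\<gamma>\<close>\<close>

text \<open>The relations are the quantum Weyl relation multiplied by \<open>d\<close> from the left
  and by \<open>u\<close> from the right.\<close>

lemma du_rep_of_weyl:
  assumes "lin D" "lin U" "\<And>x. D (U x) = smult \<alpha> (U (D x)) + smult \<gamma> x"
  shows "du_rep \<alpha> \<gamma> D U"
  using assms unfolding du_rep_def by (simp add: lin_add lin_smult)

lemma du_rep_of_right_inverse:
  assumes "lin D" "lin U" "\<And>x. D (U x) = smult s x" "s = \<alpha> * s + \<gamma>"
  shows "du_rep \<alpha> \<gamma> D U"
  using assms unfolding du_rep_def by (simp add: lin_smult flip: smult_add_left)

text \<open>The point carries the tangent vector \<open>d = t (1 + \<epsilon>)\<close>,
  \<open>u = (s' / t) (1 - \<epsilon>)\<close>. For nonzero \<gamma> the origin has zero tangent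
  space, so the image is not the origin and lies on the hyperbola.\<close>

lemma transfer_hyperbola:
  assumes tr: "transfer P Q P' Q' \<alpha> \<gamma> \<alpha>' \<gamma>'" and "\<alpha> \<noteq> 1" "\<gamma> \<noteq> 0" "\<alpha>' \<noteq> 1"
    and s': "s' = \<gamma>' / (1 - \<alpha>')" and t: "t \<noteq> 0"
  shows "chi t (s' / t) P * chi t (s' / t) Q = \<gamma> / (1 - \<alpha>)"
proof -
  define D where "D x = smult t x + [:t * coeff x 1:]" for x
  define U where "U x = smult (s' / t) x + [:- (s' / t) * coeff x 1:]" for x
  let ?e = "[:0, 1:] :: 'a poly"
  let ?a = "chi t (s' / t) P" and ?b = "chi t (s' / t) Q"
  have s'_eq: "s' = \<alpha>' * s' + \<gamma>'" using assms by (simp add: field_simps)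
  have lin: "lin D" "lin U" by (simp_all add: lin_def D_def U_def smult_add_right algebra_simps)
  have "D (U x) = smult s' x" for x using t by (simp add: D_def U_def smult_add_right)
  then have rep: "du_rep \<alpha>' \<gamma>' D U" using du_rep_of_right_inverse[OF lin _ s'_eq] by blast
  have one: "D 1 = [:t:]" "U 1 = [:s' / t:]" by (simp_all add: D_def U_def)
  have e: "D ?e = smult t ?e + [:t:]" "U ?e = smult (s' / t) ?e + [:- (s' / t):]"
    by (simp_all add: D_def U_def)
  obtain X Y where XY: "ev D U P 1 = [:?a:]" "ev D U Q 1 = [:?b:]"
    "ev D U P ?e = smult ?a ?e + [:X:]" "ev D U Q ?e = smult ?b ?e + [:Y:]"
    by (rule transfer_triangular[OF tr rep one e])
  have rep': "du_rep \<alpha> \<gamma> (ev D U P) (ev D U Q)" and inv: "ev (ev D U P) (ev D U Q) P' = D"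
    using tr rep by (simp_all add: transfer_def)
  have pt: "du_pt \<alpha>' \<gamma>' t (s' / t)" using t \<open>\<alpha>' \<noteq> 1\<close> by (simp add: du_pt_def s')
  have "\<not> (?a = 0 \<and> ?b = 0)"
  proof
    assume 0: "?a = 0 \<and> ?b = 0"
    then have "X = 0" "Y = 0"
      using du_rep_triangular[OF rep' _ XY] \<open>\<gamma> \<noteq> 0\<close> by simp_all
    then have "ev D U P ?e = smult 0 ?e" "ev D U Q ?e = smult 0 ?e" using XY 0 by simp_all
    then have "D ?e = smult (chi 0 0 P') ?e"
      using ev_eigenvector[OF lin_ev[OF lin] lin_ev[OF lin]] inv by metis
    then show False using t by (simp add: D_def)
  qed
  moreover have "?a * (?a * ?b * (1 - \<alpha>) - \<gamma>) = 0" "?b * (?a * ?b * (1 - \<alpha>) - \<gamma>) = 0"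
    using transfer_pt(1)[OF tr pt] by (simp_all add: du_pt_def algebra_simps)
  ultimately have "?a * ?b * (1 - \<alpha>) = \<gamma>" by auto
  then show ?thesis using \<open>\<alpha> \<noteq> 1\<close> by (simp add: field_simps)
qed

section \<open>The Toeplitz module and the induced map of hyperbolas\<close>

text \<open>\<open>poly_shift 1\<close> drops the constant coefficient and divides by the variable,
  so this backward shift inverts the forward shift on one side only.\<close>

definition toep_d :: "'a::field op" where
  "toep_d x = poly_shift 1 x"
definition toep_u :: "'a::field \<Rightarrow> 'a op" where
  "toep_u s x = smult s (pCons 0 x)"

lemma lin_toep: "lin toep_d" "lin (toep_u s)"
  by (auto simp: lin_def toep_u_def poly_eq_iff toep_d_def coeff_poly_shift coeff_pCons algebra_simps split: nat.splits)

lemma toep_right_inverse: "toep_d (toep_u s x) = smult s x"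
  by (simp add: poly_eq_iff toep_d_def coeff_poly_shift toep_u_def)

lemma toep_monom:
  "toep_u s (monom c n) = monom (s * c) (Suc n)" "toep_d (monom c (Suc n)) = monom c n"
  by (simp_all add: poly_eq_iff toep_d_def coeff_poly_shift toep_u_def coeff_pCons split: nat.splits)

text \<open>As long as the constants are not hit by \<open>toep_d\<close>, a word multiplies by a
  Laurent monomial, whose value at \<open>\<tau>\<close> is the value of the word at the point
  \<open>d = 1 / \<tau>\<close>, \<open>u = s \<tau>\<close>.\<close>

lemma act_toep_monom:
  fixes \<tau> s :: "'a::field"
  assumes "\<tau> \<noteq> 0" "length w \<le> n"
  shows "\<exists>c m. act toep_d (toep_u s) w (monom 1 n) = monom c m \<and> n \<le> m + length w \<and>
    c * \<tau> ^ m = \<tau> ^ n * prod_list (map (\<lambda>l. if l then s * \<tau> else 1 / \<tau>) w)"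
  using assms(2)
proof (induction w)
  case Nil
  show ?case by (intro exI[of _ 1] exI[of _ n]) simp
next
  case (Cons l w)
  then obtain c m where *: "act toep_d (toep_u s) w (monom 1 n) = monom c m" "n \<le> m + length w"
    "c * \<tau> ^ m = \<tau> ^ n * prod_list (map (\<lambda>l. if l then s * \<tau> else 1 / \<tau>) w)"
    by auto
  show ?case
  proof (cases l)
    case True
    have "s * c * \<tau> ^ Suc m = s * \<tau> * (c * \<tau> ^ m)" by simp
    then show ?thesis using * True by (auto simp: toep_monom mult_ac intro!: exI[of _ "s * c"] exI[of _ "Suc m"])
  next
    case False
    \<comment> \<open>Each letter lowers the degree by at most one, so a degree of at least one is
      left for this letter.\<close>
    obtain m' where m': "m = Suc m'" using * Cons.prems by (cases m) auto
    have "c * \<tau> ^ m' = 1 / \<tau> * (c * \<tau> ^ m)" using assms(1) by (simp add: m')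
    then show ?thesis using * False toep_monom(2)[of c m']
      by (auto simp: m' field_simps assms(1) intro!: exI[of _ c] exI[of _ m'])
  qed
qed

text \<open>The symbol of the Toeplitz operator of \<open>p\<close> is its character along the
  hyperbola; monomials of degree at least the longest word length do not feel the
  truncation.\<close>

lemma poly_ev_toep:
  fixes s :: "'a::field"
  assumes "p \<in> FA"
  obtains N where "\<And>n \<tau>. n \<ge> N \<Longrightarrow> \<tau> \<noteq> 0 \<Longrightarrow>
    poly (ev toep_d (toep_u s) p (monom 1 n)) \<tau> = \<tau> ^ n * chi (1 / \<tau>) (s * \<tau>) p"
proof -
  have "finite (length ` supp p)" using assms by (simp add: FA_iff)
  then obtain N where N: "\<forall>w\<in>supp p. length w \<le> N"
    unfolding finite_nat_set_iff_bounded_le by blast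
  have "poly (ev toep_d (toep_u s) p (monom 1 n)) \<tau> = \<tau> ^ n * chi (1 / \<tau>) (s * \<tau>) p"
    if "n \<ge> N" "\<tau> \<noteq> 0" for n \<tau>
  proof -
    have "poly (act toep_d (toep_u s) w (monom 1 n)) \<tau>
        = \<tau> ^ n * prod_list (map (\<lambda>l. if l then s * \<tau> else 1 / \<tau>) w)" if "w \<in> supp p" for w
    proof -
      have "length w \<le> n" using N \<open>n \<ge> N\<close> that by (meson le_trans)
      then show ?thesis using act_toep_monom[OF \<open>\<tau> \<noteq> 0\<close>, of w n s] by (auto simp: poly_monom)
    qed
    then show ?thesis
      unfolding ev_def chi_def sum_distrib_left by (auto simp: poly_sum mult_ac intro!: sum.cong)
  qed
  then show ?thesis using that by blast
qed

lemma poly_eqI_nonzero: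
  fixes p q :: "'a::field_char_0 poly"
  assumes "\<And>x. x \<noteq> 0 \<Longrightarrow> poly p x = poly q x"
  shows "p = q"
proof -
  have "poly (pCons 0 p) x = poly (pCons 0 q) x" for x using assms[of x] by (cases "x = 0") auto
  then have "pCons 0 p = pCons 0 q" by (simp add: poly_eq_poly_eq_iff[symmetric] fun_eq_iff del: poly_pCons)
  then show ?thesis by simp
qed

lemma monom_factor:
  fixes p q :: "'a::field poly"
  assumes "p * q = monom s n" "s \<noteq> 0"
  shows "\<exists>c j. c \<noteq> 0 \<and> p = monom c j"
  using assms(1)
proof (induction n arbitrary: p q)
  case 0
  have "p \<noteq> 0" "q \<noteq> 0" using 0 assms(2) by auto
  moreover have "degree (p * q) = 0" using 0 assms(2) by (simp add: degree_monom_eq)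
  ultimately have "degree p = 0" by (simp add: degree_mult_eq)
  then obtain c where "p = [:c:]" by (elim degree_eq_zeroE)
  then show ?case using \<open>p \<noteq> 0\<close> by (metis monom_0 pCons_eq_0_iff)
next
  case (Suc n)
  have "poly p 0 * poly q 0 = 0"
    using arg_cong[OF Suc.prems, of "\<lambda>r. poly r 0"] by (simp add: poly_monom)
  then consider p' where "p = pCons 0 p'" | q' where "q = pCons 0 q'"
    by (metis mult_eq_0_iff pCons_cases poly_0_coeff_0 coeff_pCons_0)
  then show ?case
  proof cases
    case 1
    then have "p' * q = monom s n" using Suc.prems by (simp add: monom_Suc)
    then show ?thesis using Suc.IH 1 by (metis monom_Suc)
  next
    case 2
    then have "p * q' = monom s n" using Suc.prems by (simp add: monom_Suc)
    then show ?thesis using Suc.IH by blast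
  qed
qed

text \<open>The values of \<open>P\<close> and \<open>Q\<close> along the hyperbola have a nonzero
  constant product, so they are units among Laurent polynomials, that is, monomials. Multiplication
  by a high power of \<open>\<tau>\<close> turns this into a factorization of a monomial.\<close>

lemma transfer_monomial:
  fixes \<alpha> \<alpha>' :: "'a::field_char_0"
  assumes tr: "transfer P Q P' Q' \<alpha> \<gamma> \<alpha>' \<gamma>'" and "\<alpha> \<noteq> 1" "\<gamma> \<noteq> 0" "\<alpha>' \<noteq> 1"
    and s': "s' = \<gamma>' / (1 - \<alpha>')"
  obtains c k where "c \<noteq> 0" "\<And>t. t \<noteq> 0 \<Longrightarrow> chi t (s' / t) P = c * t powi k"
proof -
  let ?s = "\<gamma> / (1 - \<alpha>)" and ?ev = "ev toep_d (toep_u s')"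
  have FA: "P \<in> FA" "Q \<in> FA" using tr by (simp_all add: transfer_def)
  obtain N1 where N1: "\<And>n \<tau>. n \<ge> N1 \<Longrightarrow> \<tau> \<noteq> 0 \<Longrightarrow>
      poly (?ev P (monom 1 n)) \<tau> = \<tau> ^ n * chi (1 / \<tau>) (s' * \<tau>) P"
    using poly_ev_toep[OF FA(1)] by metis
  obtain N2 where N2: "\<And>n \<tau>. n \<ge> N2 \<Longrightarrow> \<tau> \<noteq> 0 \<Longrightarrow>
      poly (?ev Q (monom 1 n)) \<tau> = \<tau> ^ n * chi (1 / \<tau>) (s' * \<tau>) Q"
    using poly_ev_toep[OF FA(2)] by metis
  define N where "N = max N1 N2"
  have N: "poly (?ev P (monom 1 N)) \<tau> = \<tau> ^ N * chi (1 / \<tau>) (s' * \<tau>) P"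
    "poly (?ev Q (monom 1 N)) \<tau> = \<tau> ^ N * chi (1 / \<tau>) (s' * \<tau>) Q" if "\<tau> \<noteq> 0" for \<tau>
    using N1[of N] N2[of N] that by (simp_all add: N_def)
  have "?ev P (monom 1 N) * ?ev Q (monom 1 N) = monom ?s (N + N)"
  proof (rule poly_eqI_nonzero)
    fix \<tau> :: 'a assume \<tau>: "\<tau> \<noteq> 0"
    have "chi (1 / \<tau>) (s' * \<tau>) P * chi (1 / \<tau>) (s' * \<tau>) Q = ?s"
      using transfer_hyperbola[OF assms, of "1 / \<tau>"] \<tau> by simp
    then have "\<tau> ^ N * chi (1 / \<tau>) (s' * \<tau>) P * (\<tau> ^ N * chi (1 / \<tau>) (s' * \<tau>) Q) = ?s * \<tau> ^ (N + N)"
      by (simp add: power_add algebra_simps)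
    then show "poly (?ev P (monom 1 N) * ?ev Q (monom 1 N)) \<tau> = poly (monom ?s (N + N)) \<tau>"
      by (simp add: N[OF \<tau>] poly_monom)
  qed
  then obtain c j where c: "c \<noteq> 0" "?ev P (monom 1 N) = monom c j"
    using monom_factor assms(2,3) by (metis divide_eq_0_iff eq_iff_diff_eq_0)
  have "chi t (s' / t) P = c * t powi (int N - int j)" if "t \<noteq> 0" for t
    using N(1)[of "1 / t"] that c(2)
    by (simp add: poly_monom power_int_diff field_simps)
  then show ?thesis using that c(1) by blast
qed

lemma two_powi_eq_one:
  assumes "(2 :: 'a::field_char_0) powi k = 1"
  shows "k = 0"
proof -
  have "(2::'a) ^ nat \<bar>k\<bar> = 1"
    using assms by (cases "k \<ge> 0") (auto simp: power_int_def power_one_over)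
  then have "(of_nat (2 ^ nat \<bar>k\<bar>) :: 'a) = of_nat 1" by simp
  then have "(2::nat) ^ nat \<bar>k\<bar> = 1" unfolding of_nat_eq_iff .
  then show ?thesis by simp
qed

text \<open>The power maps with exponents \<open>k\<close> and \<open>k'\<close> compose to the
  identity. Comparing the values at 1 and 2 gives \<open>k k' = 1\<close>, because 2 has infinite
  order in characteristic zero.\<close>

lemma transfer_degree_one:
  fixes \<alpha> \<alpha>' :: "'a::field_char_0"
  assumes tr: "transfer P Q P' Q' \<alpha> \<gamma> \<alpha>' \<gamma>'" and tr': "transfer P' Q' P Q \<alpha>' \<gamma>' \<alpha> \<gamma>"
    and nz: "\<alpha> \<noteq> 1" "\<gamma> \<noteq> 0" "\<alpha>' \<noteq> 1" "\<gamma>' \<noteq> 0"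
    and s': "s' = \<gamma>' / (1 - \<alpha>')"
  obtains c where "c \<noteq> 0" "\<And>t. t \<noteq> 0 \<Longrightarrow> chi t (s' / t) P = c * t"
  | c where "c \<noteq> 0" "\<And>t. t \<noteq> 0 \<Longrightarrow> chi t (s' / t) P = c / t"
proof -
  let ?s = "\<gamma> / (1 - \<alpha>)"
  obtain c k where c: "c \<noteq> 0" "\<And>t. t \<noteq> 0 \<Longrightarrow> chi t (s' / t) P = c * t powi k"
    using transfer_monomial[OF tr nz(1-3) s'] by metis
  obtain c' k' where c': "c' \<noteq> 0" "\<And>t. t \<noteq> 0 \<Longrightarrow> chi t (?s / t) P' = c' * t powi k'"
    using transfer_monomial[OF tr' nz(3,4,1) refl] by metis
  have comp: "t = c' * (c * t powi k) powi k'" if t: "t \<noteq> 0" for t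
  proof -
    have pt: "du_pt \<alpha>' \<gamma>' t (s' / t)" using t nz by (simp add: du_pt_def s')
    have x: "chi t (s' / t) P = c * t powi k" "c * t powi k \<noteq> 0" using c t by auto
    have "chi t (s' / t) Q = ?s / (c * t powi k)"
      using transfer_hyperbola[OF tr nz(1-3) s' t] x
      by (subst nonzero_eq_divide_eq) (simp_all add: mult.commute)
    then have "chi (c * t powi k) (?s / (c * t powi k)) P' = t"
      using transfer_pt(2)[OF tr pt] x by simp
    then show ?thesis using c'(2)[OF x(2)] by simp
  qed
  have 1: "c' * c powi k' = 1" using comp[of 1] by simp
  have "(2::'a) = c' * c powi k' * 2 powi (k * k')"
    using comp[of 2] by (simp add: power_int_mult_distrib power_int_mult mult.assoc)
  then have "(2::'a) powi (k * k' - 1) = 1" by (simp add: 1 power_int_diff)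
  then have "k * k' = 1" using two_powi_eq_one by fastforce
  then have "k = 1 \<or> k = -1" using zmult_eq_1_iff by auto
  then show ?thesis
  proof
    assume "k = 1"
    then show ?thesis using that(1) c by simp
  next
    assume "k = -1"
    then show ?thesis using that(2)[of c] c by (simp add: power_int_minus divide_inverse)
  qed
qed

section \<open>Orientation of the shift: excluding inversion of the hyperbola\<close>

text \<open>The span of the \<open>U\<close>-orbits of the kernel of \<open>D\<close>; scalars are
  absorbed into the kernel vector.\<close>

inductive_set hw_span :: "'a::field op \<Rightarrow> 'a op \<Rightarrow> 'a poly set" for D U where
  gen: "D v = 0 \<Longrightarrow> (U ^^ i) v \<in> hw_span D U"
| add: "x \<in> hw_span D U \<Longrightarrow> y \<in> hw_span D U \<Longrightarrow> x + y \<in> hw_span D U"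

lemma lin_funpow: "lin T \<Longrightarrow> lin (T ^^ i)"
  by (induction i) (auto simp: lin_def)

lemma subsp_hw_span:
  assumes "lin D" "lin U"
  shows "subsp (hw_span D U)"
proof -
  have "smult c x \<in> hw_span D U" if "x \<in> hw_span D U" for c x
    using that
  proof induction
    case (gen v i)
    then have "D (smult c v) = 0" using assms by (simp add: lin_smult)
    then show ?case using hw_span.gen[of D "smult c v" i U] lin_smult[OF lin_funpow[OF assms(2)]] by metis
  qed (simp add: smult_add_right hw_span.add)
  then show ?thesis
    using hw_span.gen[of D 0 0 U] lin_zero[OF assms(1)] by (auto simp: subsp_def intro: hw_span.add)
qed

text \<open>The first relation puts \<open>D (U v)\<close> into the kernel of \<open>D\<close>
  whenever \<open>v\<close> is there. The second moves \<open>D\<close> past further powers of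
  \<open>U\<close>, turning the kernel vector \<open>v'\<close> into
  \<open>\<alpha> v' + \<gamma> v\<close>.\<close>

lemma hw_span_closed:
  assumes rep: "du_rep \<alpha> \<gamma> D U" and x: "x \<in> hw_span D U"
  shows "D x \<in> hw_span D U" "U x \<in> hw_span D U"
proof -
  have lin: "lin D" "lin U" using rep by (simp_all add: du_rep_def)
  have ex: "\<exists>v'. D v' = 0 \<and> D ((U ^^ Suc i) v) = (U ^^ i) v'" if v: "D v = 0" for i v
  proof (induction i)
    case 0
    have "D (D (U v)) = 0" using rep v lin by (simp add: du_rep_def lin_zero)
    then show ?case by auto
  next
    case (Suc i)
    then obtain v' where v': "D v' = 0" "D ((U ^^ Suc i) v) = (U ^^ i) v'" by blast
    have "D ((U ^^ Suc (Suc i)) v) = smult \<alpha> (U (D (U ((U ^^ i) v)))) + smult \<gamma> (U ((U ^^ i) v))"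
      using rep by (simp add: du_rep_def)
    also have "\<dots> = (U ^^ Suc i) (smult \<alpha> v' + smult \<gamma> v)"
      using v'(2) lin(2) lin_funpow[OF lin(2), of i] by (simp add: lin_add lin_smult)
    finally show ?case using v' v lin(1) by (metis add.right_neutral lin_add lin_smult smult_0_right)
  qed
  show "D x \<in> hw_span D U" using x
  proof induction
    case (gen v i)
    show ?case
    proof (cases i)
      case 0
      then show ?thesis using gen hw_span.gen[of D 0 0 U] lin_zero[OF lin(1)] by simp
    next
      case (Suc j)
      then show ?thesis using ex[OF gen, of j] hw_span.gen by metis
    qed
  qed (simp add: lin_add[OF lin(1)] hw_span.add)
  show "U x \<in> hw_span D U" using x
  proof induction
    case (gen v i)
    then show ?case using hw_span.gen[of D v "Suc i" U] by simp
  qed (simp add: lin_add[OF lin(2)] hw_span.add)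
qed

lemma lin_monom_sum:
  assumes "lin T"
  shows "T x = (\<Sum>i\<le>degree x. smult (coeff x i) (T (monom 1 i)))"
proof -
  have "T x = T (\<Sum>i\<le>degree x. smult (coeff x i) (monom 1 i))"
    by (simp add: smult_monom poly_as_sum_of_monoms)
  then show ?thesis by (simp add: lin_sum[OF assms] lin_smult[OF assms])
qed

lemma toep_u_funpow: "s \<noteq> 0 \<Longrightarrow> x \<noteq> 0 \<Longrightarrow> degree ((toep_u s ^^ n) x) = degree x + n \<and> (toep_u s ^^ n) x \<noteq> 0"
  by (induction n) (auto simp: toep_u_def)

text \<open>The module obtained by pulling the Toeplitz representation back cannot shift the degree the
  wrong way. Otherwise \<open>U\<close> preserves a space of polynomials of bounded degree that contains the
  kernel of \<open>D\<close>, so a nonzero kernel would generate a submodule of bounded degree, which the shift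
  \<open>toep_u\<close> does not preserve. If \<open>D\<close> is injective, then the vectors with \<open>D U x = s x\<close> form a submodule
  containing a monomial, hence everything, and \<open>D\<close>, \<open>U\<close> commute.\<close>

lemma no_reversing_module:
  fixes \<alpha> \<gamma> s s' b c :: "'a::field"
  assumes rep: "du_rep \<alpha> \<gamma> D U"
    and P': "ev D U P' = toep_d" and Q': "ev D U Q' = toep_u s'"
    and nz: "s \<noteq> 0" "s' \<noteq> 0" and s: "s = \<alpha> * s + \<gamma>" and bc: "b * c = s"
    and D: "\<And>n. n \<ge> N \<Longrightarrow> D (monom 1 n) = monom c (Suc n)"
    and U: "\<And>n. n \<ge> N \<Longrightarrow> U (monom 1 (Suc n)) = monom b n"
  shows False
proof -
  have lin: "lin D" "lin U" using rep by (simp_all add: du_rep_def)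
  have c: "c \<noteq> 0" "b \<noteq> 0" using bc nz by auto
  have stable: "toep_d x \<in> S" "toep_u s' x \<in> S"
    if "subsp S" "\<And>x. x \<in> S \<Longrightarrow> D x \<in> S" "\<And>x. x \<in> S \<Longrightarrow> U x \<in> S" "x \<in> S" for S x
    using ev_closed[OF that(1), of D U x P'] ev_closed[OF that(1), of D U x Q'] that P' Q' by auto
  have inj: "v = 0" if v: "D v = 0" for v
  proof (rule ccontr)
    assume "v \<noteq> 0"
    \<comment> \<open>The bound exceeds \<open>N\<close> and the degrees of all images of monomials
      up to \<open>N\<close>. Below it \<open>U\<close> preserves degree bounds; from it on
      \<open>D\<close> raises the degree by exactly one.\<close>
    define M where "M = Suc (Suc N + (\<Sum>i\<le>N. degree (D (monom 1 i)) + degree (U (monom 1 i))))"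
    have M: "degree (D (monom 1 i)) < M" "degree (U (monom 1 i)) < M" if "i \<le> N" for i
      using member_le_sum[of i "{..N}" "\<lambda>i. degree (D (monom 1 i)) + degree (U (monom 1 i))"] that
      by (auto simp: M_def)
    let ?F = "{x. degree x < M}"
    have F: "subsp ?F"
      by (auto simp: subsp_def M_def intro: degree_add_less le_less_trans[OF degree_smult_le])
    have U_F: "U x \<in> ?F" if "x \<in> ?F" for x
    proof -
      have "U (monom 1 i) \<in> ?F" if "i < M" for i
      proof (cases "i \<le> N")
        case False
        then obtain n where "i = Suc n" "n \<ge> N" by (cases i) auto
        then show ?thesis using U that c by (simp add: degree_monom_eq)
      qed (use M in auto)
      then show ?thesis
        using that F by (subst lin_monom_sum[OF lin(2)]) (intro subsp_sum, auto simp: subsp_def)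
    qed
    have ker_F: "w \<in> ?F" if "D w = 0" for w
    proof (rule ccontr)
      assume "w \<notin> ?F"
      then have w: "degree w \<ge> M" by simp
      then have w_N: "degree w \<ge> N" by (simp add: M_def)
      \<comment> \<open>Only the leading monomial of \<open>w\<close> reaches the next degree, where
        \<open>D w\<close> has the coefficient \<open>lead_coeff w * c\<close>.\<close>
      have low: "coeff (D (monom 1 i)) (Suc (degree w)) = 0" if "i < degree w" for i
      proof (cases "i \<le> N")
        case True
        then have "degree (D (monom 1 i)) < Suc (degree w)" using M(1)[OF True] w by simp
        then show ?thesis by (rule coeff_eq_0)
      qed (use D[of i] that in auto)
      have "0 = coeff (D w) (Suc (degree w))" using that by simp
      also have "\<dots> = (\<Sum>i\<le>degree w. coeff w i * coeff (D (monom 1 i)) (Suc (degree w)))"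
        by (subst lin_monom_sum[OF lin(1)]) (simp add: coeff_sum)
      also have "\<dots> = (\<Sum>i\<le>degree w. if i = degree w then lead_coeff w * c else 0)"
        using low D[OF w_N] by (intro sum.cong) auto
      finally have "lead_coeff w = 0" using c by simp
      then have "w = 0" by simp
      then show False using w by (simp add: M_def)
    qed
    have sub_F: "hw_span D U \<subseteq> ?F"
    proof
      fix x assume "x \<in> hw_span D U"
      then show "x \<in> ?F"
      proof induction
        case (gen v i)
        then show ?case using ker_F U_F by (induction i) auto
      qed (use F in \<open>auto simp: subsp_def\<close>)
    qed
    have "(toep_u s' ^^ n) v \<in> hw_span D U" for n
    proof (induction n)
      case 0
      then show ?case using hw_span.gen[of D v 0 U] v by simp
    next
      case (Suc n)
      then show ?case using stable(2)[OF subsp_hw_span[OF lin]] hw_span_closed[OF rep] by simp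
    qed
    then have "degree ((toep_u s' ^^ M) v) < M" using sub_F by blast
    then show False using toep_u_funpow[OF nz(2) \<open>v \<noteq> 0\<close>, of M] by simp
  qed
  \<comment> \<open>The first relation says that \<open>D\<close> kills the difference of both
    sides.\<close>
  have weyl: "D (U x) = smult \<alpha> (U (D x)) + smult \<gamma> x" for x
  proof -
    have "D (D (U x) - (smult \<alpha> (U (D x)) + smult \<gamma> x)) = 0"
      using rep by (simp add: du_rep_def lin_diff lin_add lin_smult)
    then show ?thesis using inj by fastforce
  qed
  have DU: "D (U x) = smult s x" for x
  proof (cases "\<alpha> = 0")
    case True
    then show ?thesis using weyl s by simp
  next
    case False
    let ?S = "{x. D (U x) = smult s x}"
    have S: "subsp ?S" using lin by (auto simp: subsp_def lin_zero lin_add lin_smult smult_add_right mult.commute)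
    \<comment> \<open>On this space the Weyl relation gives
      \<open>\<alpha> U D x = (s - \<gamma>) x = \<alpha> s x\<close>, and \<alpha> cancels.\<close>
    have D_S: "D x \<in> ?S" if "x \<in> ?S" for x
    proof -
      have "smult \<alpha> (U (D x)) = smult (s - \<gamma>) x"
        using weyl[of x] that by (simp add: smult_diff_left algebra_simps)
      also have "s - \<gamma> = \<alpha> * s" using s by (simp add: algebra_simps)
      finally have "smult (inverse \<alpha>) (smult \<alpha> (U (D x))) = smult (inverse \<alpha>) (smult (\<alpha> * s) x)" by simp
      then have "U (D x) = smult s x" using False by (simp flip: mult.assoc)
      then show ?thesis using lin by (simp add: lin_smult)
    qed
    have U_S: "U x \<in> ?S" if "x \<in> ?S" for x
    proof -
      have "D (U (U x)) = smult (\<alpha> * s + \<gamma>) (U x)"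
        using weyl[of "U x"] that lin by (simp add: lin_smult smult_add_left)
      then show ?thesis using s by simp
    qed
    have "monom 1 (Suc N) \<in> ?S"
    proof -
      have "D (monom b N) = smult b (D (monom 1 N))"
        using lin_smult[OF lin(1), of b "monom 1 N"] by (simp add: smult_monom)
      then show ?thesis using U[of N] D[of N] bc by (simp add: smult_monom)
    qed
    \<comment> \<open>The submodule is stable under both shifts: the backward one leads down to 1,
      the forward one from there to every monomial.\<close>
    moreover have "monom 1 n \<in> ?S \<Longrightarrow> monom 1 0 \<in> ?S" for n
    proof (induction n)
      case (Suc n)
      then show ?case using stable(1)[OF S D_S U_S Suc.prems] toep_monom(2)[of "1::'a" n] by metis
    qed
    ultimately have zero: "monom 1 0 \<in> ?S" by blast
    have mon: "monom 1 n \<in> ?S" for n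
    proof (induction n)
      case (Suc n)
      have "toep_u s' (monom 1 n) \<in> ?S" using stable(2)[OF S D_S U_S Suc.IH] .
      then have "smult (inverse s') (toep_u s' (monom 1 n)) \<in> ?S" using S unfolding subsp_def by blast
      then show ?case using nz by (simp add: toep_monom smult_monom)
    qed (rule zero)
    have "id x \<in> ?S"
      using S mon by (subst lin_monom_sum[of id]) (simp add: lin_def, intro subsp_sum, auto simp: subsp_def)
    then show ?thesis by simp
  qed
  have UD: "U (D x) = smult s x" for x
  proof -
    have "D (U (D x) - smult s x) = 0" using DU lin by (simp add: lin_diff lin_smult)
    then show ?thesis using inj by fastforce
  qed
  \<comment> \<open>Both products are now the scalar \<open>s\<close>, so the whole image of the
    free algebra is commutative; but the two shifts do not commute on 1.\<close>
  have comm: "ev D U p (ev D U q x) = ev D U q (ev D U p x)" for p q x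
    by (rule ev_commute[OF lin_ev[OF lin]]; rule ev_commute[symmetric]) (use lin DU UD in auto)
  have "toep_d (toep_u s' 1) = toep_u s' (toep_d 1)"
    using comm[of P' Q' 1] by (simp add: P' Q')
  moreover have "toep_d (1 :: 'a poly) = 0"
    by (simp add: poly_eq_iff toep_d_def coeff_poly_shift)
  ultimately show False using nz toep_right_inverse[of s' 1] by (simp add: toep_u_def)
qed

text \<open>Under inversion, \<open>P\<close> raises and \<open>Q\<close> lowers the degree of all
  large monomials by one, with factors \<open>c\<close> and \<open>s / c\<close>, as
  \<open>no_reversing_module\<close> excludes.\<close>

lemma transfer_degree_not_reversed:
  fixes \<alpha> \<alpha>' :: "'a::field_char_0"
  assumes tr: "transfer P Q P' Q' \<alpha> \<gamma> \<alpha>' \<gamma>'"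
    and nz: "\<alpha> \<noteq> 1" "\<gamma> \<noteq> 0" "\<alpha>' \<noteq> 1" "\<gamma>' \<noteq> 0"
    and s': "s' = \<gamma>' / (1 - \<alpha>')"
    and c: "c \<noteq> 0" "\<And>t. t \<noteq> 0 \<Longrightarrow> chi t (s' / t) P = c / t"
  shows False
proof -
  define s where "s = \<gamma> / (1 - \<alpha>)"
  let ?ev = "ev toep_d (toep_u s')"
  have FA: "P \<in> FA" "Q \<in> FA" using tr by (simp_all add: transfer_def)
  obtain N1 where N1: "\<And>n \<tau>. n \<ge> N1 \<Longrightarrow> \<tau> \<noteq> 0 \<Longrightarrow>
      poly (?ev P (monom 1 n)) \<tau> = \<tau> ^ n * chi (1 / \<tau>) (s' * \<tau>) P"
    using poly_ev_toep[OF FA(1)] by metis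
  obtain N2 where N2: "\<And>n \<tau>. n \<ge> N2 \<Longrightarrow> \<tau> \<noteq> 0 \<Longrightarrow>
      poly (?ev Q (monom 1 n)) \<tau> = \<tau> ^ n * chi (1 / \<tau>) (s' * \<tau>) Q"
    using poly_ev_toep[OF FA(2)] by metis
  have chi_P: "chi (1 / \<tau>) (s' * \<tau>) P = c * \<tau>" if "\<tau> \<noteq> 0" for \<tau>
    using c(2)[of "1 / \<tau>"] that by simp
  have chi_Q: "chi (1 / \<tau>) (s' * \<tau>) Q * \<tau> = s / c" if "\<tau> \<noteq> 0" for \<tau>
    using transfer_hyperbola[OF tr nz(1-3) s', of "1 / \<tau>"] that c(1) chi_P[OF that]
    by (subst nonzero_eq_divide_eq) (simp_all add: s_def mult_ac)
  have D: "?ev P (monom 1 n) = monom c (Suc n)" if "n \<ge> max N1 N2" for n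
    by (rule poly_eqI_nonzero) (use that in \<open>simp add: N1 poly_monom chi_P\<close>)
  have U: "?ev Q (monom 1 (Suc n)) = monom (s / c) n" if "n \<ge> max N1 N2" for n
  proof (rule poly_eqI_nonzero)
    fix \<tau> :: 'a assume \<tau>: "\<tau> \<noteq> 0"
    have "\<tau> ^ Suc n * chi (1 / \<tau>) (s' * \<tau>) Q = \<tau> ^ n * (chi (1 / \<tau>) (s' * \<tau>) Q * \<tau>)" by simp
    then show "poly (?ev Q (monom 1 (Suc n))) \<tau> = poly (monom (s / c) n) \<tau>"
      using that \<tau> by (simp add: N2 poly_monom chi_Q del: power_Suc)
  qed
  have s'_eq: "s' = \<alpha>' * s' + \<gamma>'" and s_eq: "s = \<alpha> * s + \<gamma>"
    using nz by (simp_all add: s' s_def field_simps)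
  have rep: "du_rep \<alpha>' \<gamma>' toep_d (toep_u s')"
    by (rule du_rep_of_right_inverse[OF lin_toep toep_right_inverse s'_eq])
  have inv: "du_rep \<alpha> \<gamma> (?ev P) (?ev Q)" "ev (?ev P) (?ev Q) P' = toep_d" "ev (?ev P) (?ev Q) Q' = toep_u s'"
    using tr rep by (simp_all add: transfer_def)
  show False
    by (rule no_reversing_module[where N = "max N1 N2", OF inv _ _ s_eq _ D U]) (use nz c in \<open>auto simp: s_def s'\<close>)
qed

text \<open>Two points \<open>t\<^sub>1 \<noteq> t\<^sub>2\<close> of the hyperbola have a nonsplit extension only if \<open>t\<^sub>1 = \<alpha> t\<^sub>2\<close>.\<close>

lemma transfer_alpha_nonzero:
  fixes \<alpha> \<alpha>' :: "'a::field_char_0"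
  assumes tr: "transfer P Q P' Q' \<alpha> \<gamma> \<alpha>' \<gamma>'"
    and nz: "\<alpha> \<noteq> 1" "\<gamma> \<noteq> 0" "\<alpha>' \<noteq> 1" "\<alpha>' \<noteq> 0"
    and s': "s' = \<gamma>' / (1 - \<alpha>')"
    and c: "c \<noteq> 0" "\<And>t. t \<noteq> 0 \<Longrightarrow> chi t (s' / t) P = c * t"
  shows "\<alpha>' = \<alpha>"
proof (rule ccontr)
  assume neq: "\<alpha>' \<noteq> \<alpha>"
  define s where "s = \<gamma> / (1 - \<alpha>)"
  have s'_eq: "s' = \<alpha>' * s' + \<gamma>'" and \<gamma>: "\<gamma> = s * (1 - \<alpha>)"
    using nz by (simp_all add: s' s_def field_simps)
  \<comment> \<open>The nonsplit extension of the point \<open>t = 1\<close>, spanned by the class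
    of \<open>?e\<close>, by the point \<open>t = \<alpha>'\<close> on the constants.\<close>
  define D where "D x = x + [:(\<alpha>' - 1) * coeff x 0:]" for x
  define U where "U x = smult s' x + [:(s' / \<alpha>' - s') * coeff x 0 + coeff x 1:]" for x
  let ?e = "[:0, 1:] :: 'a poly"
  have lin: "lin D" "lin U" by (simp_all add: lin_def D_def U_def smult_add_right algebra_simps)
  have "D (U x) = smult \<alpha>' (U (D x)) + smult \<gamma>' x" for x
  proof -
    have DU: "D (U x) = smult s' x + [:\<alpha>' * coeff x 1:]"
      using nz by (simp add: D_def U_def field_simps)
    have UD: "U (D x) = smult s' x + [:coeff x 1:]"
      using nz by (simp add: D_def U_def smult_add_right field_simps)
    have split: "smult s' x = smult (\<alpha>' * s') x + smult \<gamma>' x"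
      using s'_eq by (simp flip: smult_add_left)
    show ?thesis unfolding DU UD by (subst split) (simp add: smult_add_right)
  qed
  then have rep: "du_rep \<alpha>' \<gamma>' D U" using du_rep_of_weyl[OF lin] by blast
  have one: "D 1 = [:\<alpha>':]" "U 1 = [:s' / \<alpha>':]" by (simp_all add: D_def U_def one_pCons)
  have e: "D ?e = smult 1 ?e + [:0:]" "U ?e = smult s' ?e + [:1:]" by (simp_all add: D_def U_def)
  have P: "chi \<alpha>' (s' / \<alpha>') P = c * \<alpha>'" "chi 1 s' P = c" using c(2)[of \<alpha>'] c(2)[of 1] nz by simp_all
  have Q: "chi \<alpha>' (s' / \<alpha>') Q = s / (c * \<alpha>')" "chi 1 s' Q = s / c"
    using transfer_hyperbola[OF tr nz(1-3) s', of \<alpha>'] transfer_hyperbola[OF tr nz(1-3) s', of 1] nz c(1)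
    by (simp_all add: P s_def field_simps)
  obtain X Y where XY: "ev D U P 1 = [:c * \<alpha>':]" "ev D U Q 1 = [:s / (c * \<alpha>'):]"
    "ev D U P ?e = smult c ?e + [:X:]" "ev D U Q ?e = smult (s / c) ?e + [:Y:]"
    using transfer_triangular[OF tr rep one e] unfolding P Q by metis
  have rep': "du_rep \<alpha> \<gamma> (ev D U P) (ev D U Q)"
    and inv: "ev (ev D U P) (ev D U Q) P' = D" "ev (ev D U P) (ev D U Q) Q' = U"
    using tr rep by (simp_all add: transfer_def)
  have "(\<alpha>' - \<alpha>) * (Y * c * c * \<alpha>' + X * s) = 0"
    using du_rep_triangular(1)[OF rep' _ XY] c(1) nz by (simp add: \<gamma> field_simps)
  then have Y: "Y * c * c * \<alpha>' = - (X * s)" using neq by (simp add: eq_neg_iff_add_eq_0)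
  \<comment> \<open>Chosen to diagonalize the image of \<open>d\<close> on the span of 1 and
    \<open>?e\<close>. The equation for \<open>Y\<close>, available since \<alpha>' differs from
    \<alpha>, makes the same vector an eigenvector for the image of \<open>u\<close>, so the pulled
    back extension splits.\<close>
  define k where "k = X / (c * (1 - \<alpha>'))"
  define v where "v = [:k, 1:]"
  have v: "v = ?e + smult k 1" by (simp add: v_def)
  have lin': "lin (ev D U P)" "lin (ev D U Q)" by (intro lin_ev lin)+
  have "X + k * (c * \<alpha>') = c * k"
    using c(1) nz by (simp add: k_def field_simps)
  then have "ev D U P v = smult c v"
    unfolding v lin'[THEN lin_add] lin'[THEN lin_smult] XY by simp
  moreover have "Y + k * (s / (c * \<alpha>')) = s / c * k"
  proof -
    have X: "X = k * c * (1 - \<alpha>')" using c(1) nz by (simp add: k_def)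
    have "c * (Y * c * \<alpha>' + k * s - k * s * \<alpha>') = 0" using Y by (simp add: X algebra_simps)
    then have "Y * c * \<alpha>' + k * s - k * s * \<alpha>' = 0" using c(1) by (simp only: mult_eq_0_iff) simp
    then have Y': "Y * c * \<alpha>' = k * s * \<alpha>' - k * s" by (simp add: algebra_simps)
    have "(Y + k * (s / (c * \<alpha>'))) * (c * \<alpha>') = Y * c * \<alpha>' + k * s"
      using c(1) nz by (simp add: distrib_right)
    also have "\<dots> = s / c * k * (c * \<alpha>')" unfolding Y' using c(1) by (simp add: mult_ac)
    finally show ?thesis using c(1) nz by (metis mult_eq_0_iff mult_right_cancel)
  qed
  then have "ev D U Q v = smult (s / c) v"
    unfolding v lin'[THEN lin_add] lin'[THEN lin_smult] XY by simp
  ultimately have "\<exists>m. D v = smult m v" "\<exists>m. U v = smult m v"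
    using ev_eigenvector[OF lin'] inv by metis+
  \<comment> \<open>The operator \<open>D\<close> forces \<open>k = 0\<close>, and then
    \<open>U\<close> adds a nonzero constant to a multiple of \<open>?e\<close>.\<close>
  then show False using nz by (auto simp: D_def U_def v_def algebra_simps)
qed

lemma transfer_filtered:
  fixes \<alpha> \<alpha>' :: "'a::field_char_0"
  assumes tr: "transfer P Q P' Q' \<alpha> \<gamma> \<alpha>' \<gamma>'" and tr': "transfer P' Q' P Q \<alpha>' \<gamma>' \<alpha> \<gamma>"
    and nz: "\<alpha> \<noteq> 1" "\<gamma> \<noteq> 0" "\<alpha>' \<noteq> 1" "\<gamma>' \<noteq> 0" "\<alpha>' \<noteq> 0"
  shows "\<alpha>' = \<alpha>"
  using transfer_degree_one[OF tr tr' nz(1-4) refl]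
    transfer_degree_not_reversed[OF tr nz(1-4) refl] transfer_alpha_nonzero[OF tr nz(1-3,5) refl]
  by metis

section \<open>The classification\<close>

theorem theorem1:
  fixes \<alpha> \<alpha>' \<gamma> \<gamma>' :: "'k::field_char_0"
  assumes "alg_closed TYPE('k)"
  shows "down_up_iso \<alpha> 0 \<gamma> \<alpha>' 0 \<gamma>' \<longleftrightarrow>
           ((\<exists>c. c \<noteq> 0 \<and> \<gamma> = c * \<gamma>') \<and> \<alpha>' = \<alpha>)"
proof
  assume "(\<exists>c. c \<noteq> 0 \<and> \<gamma> = c * \<gamma>') \<and> \<alpha>' = \<alpha>"
  then show "down_up_iso \<alpha> 0 \<gamma> \<alpha>' 0 \<gamma>'" using down_up_iso_rescale by blast
next
  assume "down_up_iso \<alpha> 0 \<gamma> \<alpha>' 0 \<gamma>'"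
  then obtain P Q P' Q' where tr: "transfer P Q P' Q' \<alpha> \<gamma> \<alpha>' \<gamma>'" and tr': "transfer P' Q' P Q \<alpha>' \<gamma>' \<alpha> \<gamma>"
    by (rule down_up_iso_imp_transfer)
  have \<gamma>: "\<gamma> = 0 \<longleftrightarrow> \<gamma>' = 0" using transfer_gamma_zero tr tr' by metis
  have "\<exists>c. c \<noteq> 0 \<and> \<gamma> = c * \<gamma>'"
  proof (cases "\<gamma>' = 0")
    case True
    then show ?thesis using \<gamma> by (auto intro!: exI[of _ 1])
  next
    case False
    then show ?thesis using \<gamma> by (auto intro!: exI[of _ "\<gamma> / \<gamma>'"])
  qed
  moreover have "\<alpha>' = \<alpha>"
  proof (cases "\<alpha> = 1 \<or> \<alpha>' = 1")
    case True
    then show ?thesis using transfer_alpha_one tr tr' by metis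
  next
    case False
    \<comment> \<open>For nonzero \<gamma> the filtered case is available in both directions, so it
      applies as soon as one of \<alpha>, \<alpha>' is nonzero; otherwise they agree
      trivially.\<close>
    then show ?thesis
      using transfer_graded tr transfer_filtered[OF tr tr'] transfer_filtered[OF tr' tr] \<gamma> by metis
  qed
  ultimately show "(\<exists>c. c \<noteq> 0 \<and> \<gamma> = c * \<gamma>') \<and> \<alpha>' = \<alpha>" by blast
qed

end
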